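(* Let $\mathbf{X}(t)=(X_1(t),\dots,X_c(t))^\top$ be a continuum Pólya-like random walk with navigation matrix $\mathbf{A}=(A_{i,j})_{i,j\in C}$, $C=\{1,\dots,c\}$. For $\mathbf{u}=(u_j)_{j\in C}$ let $$\phi(t,\mathbf{u})=\mathbb{E}\Big[\exp\Big(\sum_{j\in C}u_jX_j(t)\Big)\Big]$$ be the joint moment generating function of the coordinates of the random walk $\mathbf{X}(t)$ and, for $i\in C$, let $$\psi_i(\mathbf{u})=\mathbb{E}\Big[\exp\Big(\sum_{j\in C}u_jA_{i,j}\Big)\Big]$$ be the joint moment generating function of the random variables on row $i$ of the navigation matrix $\mathbf{A}$. Then the joint moment generating function $\phi(t,\mathbf{u})$ satisfies $$\frac{\partial \phi}{\partial t}+\sum_{i\in C}(1-\psi_i)\frac{\partial\phi}{\partial u_i}=0.$$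
   Context: Continuum Pólya-like random walk: let $C=\{1,\dots,c\}$, and let $\mathbf{A}=(A_{i,j})_{i,j\in C}$ be a matrix (the navigation matrix) whose entries are real numbers or real-valued random variables. The walk has position $\mathbf{X}(t)=(X_1(t),\dots,X_c(t))^\top\in\mathbb{R}^c$ at time $t$, with starting values $X_j(0)\in\mathbb{R}$. At any point $t$ in time, the next renewal occurs after a random amount of time given by a master clock, whose waiting time is an exponential random variable with mean $1/\sum_{i\in C}X_i(t)$. Given that a renewal occurs, the probability that it corresponds to color (type) $i$ is $X_i(t)/\sum_{j\in C}X_j(t)$. In that case the $i$th row of $\mathbf{A}$ dictates the direction in which to move: $A_{i,j}$ units are added to $X_j(t)$, for each $j\in C$. The entries of $\mathbf{A}$ may be random variables; they are only assumed to be independent of the current state $\mathbf{X}(t)$ of the process. Tenability (standing assumption): only starting values $X_j(0)$ and matrices $\mathbf{A}$ are considered for which the walk is tenable, i.e., the walk always avoids the origin and each of the coordinates is always nonnegative. *)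

theory Defs
  imports "HOL-Probability.Probability"
begin

text \<open>
  Position after the first \<open>n\<close> renewals: the \<open>(n+1)\<close>st renewal has color \<open>K n\<close> and moves the
  walk along row \<open>K n\<close> of the copy \<open>B n\<close> of the navigation matrix. As \<open>B n \<omega> :: real^'c^'c\<close> is a
  vector of rows, \<open>B n \<omega> $ i\<close> is its \<open>i\<close>th row.
\<close>

primrec renewal_position ::
  "real^'c \<Rightarrow> (nat \<Rightarrow> 'w \<Rightarrow> 'c) \<Rightarrow> (nat \<Rightarrow> 'w \<Rightarrow> real^'c^'c) \<Rightarrow> nat \<Rightarrow> 'w \<Rightarrow> real^'c::finite" where
  "renewal_position x0 K B 0 \<omega> = x0"
| "renewal_position x0 K B (Suc n) \<omega> = renewal_position x0 K B n \<omega> + B n \<omega> $ K n \<omega>"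

definition total :: "real^'c::finite \<Rightarrow> real" where
  "total x = (\<Sum>j\<in>UNIV. x $ j)"

text \<open>
  \<open>T n\<close> is the time of the \<open>n\<close>th renewal (with \<open>T 0 = 0\<close>) and \<open>F n\<close> is the history up to and
  including it. The position only changes at renewals, so by lack of memory of the exponential
  distribution it suffices to prescribe the waiting time from each renewal to the next.
  The assumption \<open>renewal_law\<close> says that, given the history \<open>F n\<close> and with
  \<open>x = renewal_position x0 K B n\<close>,
    \<^item> the waiting time is exponential with mean \<open>1 / total x\<close>,
    \<^item> the color is \<open>i\<close> with probability \<open>x $ i / total x\<close>, whatever the waiting time,
    \<^item> the copy of the matrix used is distributed as \<open>A\<close>, independently of the history, of the
      waiting time and of the color.
  Only the distribution of \<open>A\<close> matters; a matrix of real numbers is a constant \<open>A\<close>.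
  The assumption \<open>renewals_finite\<close> says that almost surely only finitely many renewals occur in
  bounded time; without it the position would not be determined at all times.
\<close>

locale polya_walk = prob_space M + filtration "space M" F
  for M :: "'w measure" and F :: "nat \<Rightarrow> 'w measure" +
  fixes A :: "'w \<Rightarrow> real^'c::finite^'c"
    and x0 :: "real^'c"
    and T :: "nat \<Rightarrow> 'w \<Rightarrow> real"
    and K :: "nat \<Rightarrow> 'w \<Rightarrow> 'c"
    and B :: "nat \<Rightarrow> 'w \<Rightarrow> real^'c^'c"
    and X :: "real \<Rightarrow> 'w \<Rightarrow> real^'c"
  assumes history: "\<And>n. subalgebra M (F n)"
    and A_measurable: "A \<in> borel_measurable M"
    and T_measurable: "\<And>n. T n \<in> borel_measurable (F n)"
    and K_measurable: "\<And>n. K n \<in> measurable (F (Suc n)) (count_space UNIV)"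
    and B_measurable: "\<And>n. B n \<in> borel_measurable (F (Suc n))"
    and X_measurable: "\<And>t. 0 \<le> t \<Longrightarrow> X t \<in> borel_measurable M"
    and T_0: "AE \<omega> in M. T 0 \<omega> = 0"
    and renewal_law: "\<And>n D i S. D \<in> sets borel \<Longrightarrow> S \<in> sets borel \<Longrightarrow>
      AE \<omega> in M.
        real_cond_exp M (F n)
          (indicat_real {\<omega>\<in>space M. T (Suc n) \<omega> - T n \<omega> \<in> D \<and> K n \<omega> = i \<and> B n \<omega> \<in> S}) \<omega> =
        measure (density lborel (exponential_density (total (renewal_position x0 K B n \<omega>)))) D
        * (renewal_position x0 K B n \<omega> $ i / total (renewal_position x0 K B n \<omega>))
        * prob {\<omega>\<in>space M. A \<omega> \<in> S}"
    and renewals_finite: "AE \<omega> in M. filterlim (\<lambda>n. T n \<omega>) at_top sequentially"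
    and X_path: "AE \<omega> in M. \<forall>n t. T n \<omega> \<le> t \<and> t < T (Suc n) \<omega> \<longrightarrow>
      X t \<omega> = renewal_position x0 K B n \<omega>"

definition tenable :: "'w measure \<Rightarrow> (real \<Rightarrow> 'w \<Rightarrow> real^'c::finite) \<Rightarrow> bool" where
  "tenable M X \<longleftrightarrow> (AE \<omega> in M. \<forall>t\<ge>0. X t \<omega> \<noteq> 0 \<and> (\<forall>j. 0 \<le> X t \<omega> $ j))"

definition joint_mgf :: "'w measure \<Rightarrow> ('w \<Rightarrow> real^'c::finite) \<Rightarrow> real^'c \<Rightarrow> real" where
  "joint_mgf M Z u = (\<integral>\<omega>. exp (\<Sum>j\<in>UNIV. u $ j * Z \<omega> $ j) \<partial>M)"

text \<open>The Bochner integral in \<open>joint_mgf\<close> is \<open>0\<close> where the expectation is infinite; the next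
  predicate excludes such arguments.\<close>

definition joint_mgf_finite :: "'w measure \<Rightarrow> ('w \<Rightarrow> real^'c::finite) \<Rightarrow> real^'c \<Rightarrow> bool" where
  "joint_mgf_finite M Z u \<longleftrightarrow> integrable M (\<lambda>\<omega>. exp (\<Sum>j\<in>UNIV. u $ j * Z \<omega> $ j))"

definition mgf_domain :: "'w measure \<Rightarrow> (real \<Rightarrow> 'w \<Rightarrow> real^'c::finite) \<Rightarrow> (real \<times> (real^'c)) set" where
  "mgf_domain M X = {(t, u). 0 \<le> t \<and> joint_mgf_finite M (X t) u}"

end

theory Submission
  imports Defs "HOL-Real_Asymp.Real_Asymp"
begin

text \<open>
  For \<open>f x = exp (u \<bullet> x)\<close>, a renewal of color \<open>i\<close> multiplies \<open>f\<close> by \<open>exp (u \<bullet> A $ i)\<close>, and in state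
  \<open>x\<close> such renewals occur at rate \<open>x $ i\<close>. The drift of \<open>f (X t)\<close> is therefore
  \<open>(\<Sum>i. (\<psi> i - 1) * X t $ i * f (X t))\<close>, and the expectation of \<open>X t $ i * f (X t)\<close> is the partial
  derivative of the moment generating function \<open>\<phi>\<close> with respect to \<open>u $ i\<close>. The equation expresses
  that the expectation of \<open>f (X t)\<close> grows at the mean drift.

  The difficulty is that \<open>f\<close> is unbounded, so that generators and martingales are only available
  after a localization. The proof avoids this by staying with nonnegative, possibly infinite
  expectations. Along a path, \<open>f (X b)\<close> plus the sum of \<open>f (state before the renewal)\<close> over the
  renewals in \<open>]a, b]\<close> equals \<open>f (X a)\<close> plus the sum of \<open>f (state after the renewal)\<close> (\<open>telescope\<close>).
  The expectation of each sum is a time integral over \<open>[a, b]\<close> (\<open>renewal_intensity\<close>), by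
  a computation for each single renewal that combines its law given the history
  (\<open>renewal_integral\<close>) with the probability that it has not occurred yet (\<open>survival\<close>).
  The resulting identity \<open>mgf_balance\<close> relates possibly infinite quantities;
  when all of them are finite it says that \<open>\<phi> b - \<phi> a\<close> is the integral of
  \<open>(\<Sum>i. (\<psi> i - 1) * g i)\<close>, where \<open>g i r\<close> is the expectation of \<open>X r $ i * f (X r)\<close>.

  It remains to see that \<open>g i\<close> is continuous, so that the fundamental theorem of calculus applies.
  Since the walk rests for a time \<open>d\<close> with probability \<open>exp (- d * total x)\<close>, the moment generating
  function at an earlier time is at most the one at a later time with a slightly larger argument
  (\<open>mgf_earlier_le\<close>). In the interior of the domain this bounds exponential moments a little beyond
  \<open>u\<close> locally uniformly in time, hence gives the uniform integrability that turns the almost sure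
  continuity of the paths at a fixed time into continuity of \<open>g i\<close> (\<open>continuous_weighted_mgf\<close>).
\<close>

section \<open>Exponential waiting times\<close>

text \<open>For a rate \<open>l \<le> 0\<close> the formula for the density is nonpositive, so it defines the null measure
  instead of a probability measure. Hence \<open>renewal_law\<close> can only hold where the rate is positive.\<close>
lemma measure_exponential_nonpos_rate:
  assumes "l \<le> 0"
  shows "measure (density lborel (exponential_density l)) D = 0"
proof -
  have "ennreal (exponential_density l x) = 0" for x :: real
    using assms by (auto simp: exponential_density_def ennreal_eq_0_iff mult_nonpos_nonneg)
  then show ?thesis
    by (cases "D \<in> sets borel") (simp_all add: measure_def emeasure_density emeasure_notin_sets)
qed

lemma measure_exponential:
  assumes "0 < l" and [measurable]: "D \<in> sets borel"
  shows "ennreal (measure (density lborel (exponential_density l)) D) =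
    (\<integral>\<^sup>+ w. ennreal (exponential_density l w) * indicator D w \<partial>lborel)"
proof -
  interpret E: prob_space "density lborel (exponential_density l)"
    by (rule prob_space_exponential_density) fact
  show ?thesis
    by (simp add: E.emeasure_eq_measure[symmetric] emeasure_density)
qed

lemma measure_exponential_atMost_0: "measure (density lborel (exponential_density l)) {..0} = 0"
proof (cases "l \<le> 0")
  case False
  have "(\<integral>\<^sup>+ w. ennreal (exponential_density l w) * indicator {..0} w \<partial>lborel) = (\<integral>\<^sup>+ (w::real). 0 \<partial>lborel)"
    using AE_lborel_singleton[of "0::real"]
    by (intro nn_integral_cong_AE) (auto simp: exponential_density_def indicator_def elim!: eventually_mono)
  with False measure_exponential[of l "{..0}"] show ?thesis
    by (simp add: ennreal_eq_0_iff)
       (metis antisym measure_nonneg)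
qed (simp add: measure_exponential_nonpos_rate)

lemma exponential_tail:
  assumes "0 < l" "0 \<le> a"
  shows "(\<integral>\<^sup>+ w. ennreal (exponential_density l w) * indicator {a<..} w \<partial>lborel) = ennreal (exp (- l * a))"
proof -
  have "(\<integral>\<^sup>+ w. ennreal (exponential_density l w) * indicator {a<..} w \<partial>lborel) =
      (\<integral>\<^sup>+ w. ennreal (l * exp (- w * l)) * indicator {a..} w \<partial>lborel)"
    using AE_lborel_singleton[of a] assms
    by (intro nn_integral_cong_AE) (auto simp: exponential_density_def indicator_def elim!: eventually_mono)
  also have "\<dots> = 0 - (- exp (- a * l))"
  proof (rule nn_integral_FTC_atLeast)
    show "((\<lambda>w. - exp (- w * l)) has_real_derivative l * exp (- w * l)) (at w)" for w
      by (auto intro!: derivative_eq_intros)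
    show "((\<lambda>w. - exp (- w * l)) \<longlongrightarrow> 0) at_top"
      using assms by real_asymp
  qed (use assms in auto)
  finally show ?thesis by (simp add: ac_simps)
qed

section \<open>The renewals of a walk\<close>

lemma vec_nth_measurable [measurable (raw)]:
  fixes f :: "'a \<Rightarrow> ('b::euclidean_space)^'c::finite"
  assumes [measurable]: "f \<in> borel_measurable M"
  shows "(\<lambda>x. f x $ i) \<in> borel_measurable M"
proof -
  have "(\<lambda>v. v $ i) \<in> borel_measurable (borel :: ('b^'c) measure)"
    by (intro borel_measurable_continuous_onI continuous_intros)
  from measurable_compose[OF assms this] show ?thesis .
qed

lemma total_measurable [measurable (raw)]:
  "f \<in> borel_measurable M \<Longrightarrow> (\<lambda>x. total (f x)) \<in> borel_measurable M"
  unfolding total_def by measurable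

context polya_walk
begin

abbreviation Y :: "nat \<Rightarrow> 'w \<Rightarrow> real^'c" where
  "Y n \<equiv> renewal_position x0 K B n"

abbreviation W :: "nat \<Rightarrow> 'w \<Rightarrow> real" where
  "W n \<omega> \<equiv> T (Suc n) \<omega> - T n \<omega>"

lemma measurable_history: "f \<in> measurable (F n) L \<Longrightarrow> f \<in> measurable M L"
  by (rule measurable_from_subalg[OF history])

lemma measurable_later: "m \<le> n \<Longrightarrow> f \<in> measurable (F m) L \<Longrightarrow> f \<in> measurable (F n) L"
  using sets_F_mono[of m n] space_F by (auto simp: measurable_def)

lemma Y_measurable: "Y n \<in> borel_measurable (F n)"
proof (induction n)
  case 0
  show ?case by simp
next
  case (Suc n)
  note [measurable] = measurable_later[OF le_SucI[OF le_refl] Suc] K_measurable B_measurable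
  have [measurable]: "(\<lambda>\<omega>. B n \<omega> $ K n \<omega>) \<in> borel_measurable (F (Suc n))"
    by (rule measurable_compose_countable'[where f="\<lambda>i \<omega>. B n \<omega> $ i" and g="K n" and I=UNIV]) auto
  show ?case by simp
qed

lemmas measurable_M [measurable] =
  measurable_history[OF T_measurable] measurable_history[OF K_measurable]
  measurable_history[OF B_measurable] measurable_history[OF Y_measurable] A_measurable

text \<open>The conditional probability in \<open>renewal_law\<close>, integrated over an event of the history.\<close>
lemma prob_renewal:
  assumes G: "G \<in> sets (F n)" and D[measurable]: "D \<in> sets borel" and S[measurable]: "S \<in> sets borel"
  shows "emeasure M {\<omega>\<in>space M. \<omega> \<in> G \<and> W n \<omega> \<in> D \<and> K n \<omega> = i \<and> B n \<omega> \<in> S} =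
    (\<integral>\<^sup>+ \<omega>. indicator G \<omega> * ennreal (measure (density lborel (exponential_density (total (Y n \<omega>)))) D
        * (Y n \<omega> $ i / total (Y n \<omega>)) * prob {\<omega>\<in>space M. A \<omega> \<in> S}) \<partial>M)"
proof -
  interpret finite_measure_subalgebra M "F n"
    by unfold_locales (rule history)
  have [measurable]: "G \<in> sets M"
    using G history[of n] by (auto simp: subalgebra_def)
  define E where "E = {\<omega>\<in>space M. W n \<omega> \<in> D \<and> K n \<omega> = i \<and> B n \<omega> \<in> S}"
  have [measurable]: "E \<in> sets M"
    unfolding E_def by measurable
  have int: "integrable M (indicat_real E)"
    by (simp add: emeasure_eq_measure)
  have int': "integrable M (real_cond_exp M (F n) (indicat_real E))"
    by (rule real_cond_exp_int(1)[OF int])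
  have pos: "AE \<omega> in M. 0 \<le> real_cond_exp M (F n) (indicat_real E) \<omega>"
    by (rule real_cond_exp_pos) auto
  have "{\<omega>\<in>space M. \<omega> \<in> G \<and> W n \<omega> \<in> D \<and> K n \<omega> = i \<and> B n \<omega> \<in> S} = G \<inter> E"
    using sets.sets_into_space[of G M] by (auto simp: E_def)
  also have "emeasure M (G \<inter> E) = ennreal (\<integral>\<omega>\<in>G. indicat_real E \<omega> \<partial>M)"
    by (simp add: set_lebesgue_integral_def emeasure_eq_measure flip: indicator_inter_arith)
  also have "(\<integral>\<omega>\<in>G. indicat_real E \<omega> \<partial>M) = (\<integral>\<omega>\<in>G. real_cond_exp M (F n) (indicat_real E) \<omega> \<partial>M)"
    by (rule real_cond_exp_intA[OF int G])
  also have "ennreal \<dots> = (\<integral>\<^sup>+ \<omega>. ennreal (indicator G \<omega> * real_cond_exp M (F n) (indicat_real E) \<omega>) \<partial>M)"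
    unfolding set_lebesgue_integral_def real_scaleR_def
    using pos by (intro nn_integral_eq_integral[symmetric] integrable_real_mult_indicator)
      (auto simp: mult.commute[of "indicator G _"] int' intro!: integrable_real_mult_indicator int')
  also have "\<dots> = (\<integral>\<^sup>+ \<omega>. indicator G \<omega> * ennreal (measure (density lborel (exponential_density (total (Y n \<omega>)))) D
        * (Y n \<omega> $ i / total (Y n \<omega>)) * prob {\<omega>\<in>space M. A \<omega> \<in> S}) \<partial>M)"
    using renewal_law[OF D S, of n i] unfolding E_def[symmetric]
    by (intro nn_integral_cong_AE) (auto simp: indicator_def)
  finally show ?thesis .
qed

text \<open>\<open>renewal_law\<close> speaks about one color at a time; as some color is always chosen, an event is null
  once it is null together with each color.\<close>
lemma AE_color_cases:
  assumes "\<And>i. emeasure M {\<omega>\<in>space M. P \<omega> \<and> K n \<omega> = i} = 0"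
    and [measurable]: "Measurable.pred M P"
  shows "AE \<omega> in M. \<not> P \<omega>"
proof -
  have "AE \<omega> in M. \<forall>i\<in>UNIV. \<not> (P \<omega> \<and> K n \<omega> = i)"
    by (intro AE_finite_allI) (auto simp: AE_iff_measurable[OF _ refl] assms)
  then show ?thesis by auto
qed

text \<open>On the event of the history that the rate is nonpositive, the waiting time would have the null
  measure as its law, so that event is null.\<close>
lemma total_pos: "AE \<omega> in M. 0 < total (Y n \<omega>)"
proof -
  have "AE \<omega> in M. \<not> total (Y n \<omega>) \<le> 0"
  proof (rule AE_color_cases[of _ n])
    fix i
    note [measurable] = Y_measurable
    have G: "{\<omega>\<in>space (F n). total (Y n \<omega>) \<le> 0} \<in> sets (F n)" by measurable
    have "{\<omega>\<in>space M. total (Y n \<omega>) \<le> 0 \<and> K n \<omega> = i} =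
      {\<omega>\<in>space M. \<omega> \<in> {\<omega>\<in>space (F n). total (Y n \<omega>) \<le> 0} \<and> W n \<omega> \<in> UNIV \<and> K n \<omega> = i \<and> B n \<omega> \<in> UNIV}"
      by (auto simp: space_F)
    also have "emeasure M \<dots> = 0"
      by (subst prob_renewal[OF G])
         (auto simp: indicator_def measure_exponential_nonpos_rate intro!: nn_integral_zero')
    finally show "emeasure M {\<omega>\<in>space M. total (Y n \<omega>) \<le> 0 \<and> K n \<omega> = i} = 0" .
  qed measurable
  then show ?thesis by (simp add: not_le)
qed

lemma waiting_time_pos: "AE \<omega> in M. 0 < W n \<omega>"
proof -
  have "AE \<omega> in M. \<not> W n \<omega> \<le> 0"
  proof (rule AE_color_cases[of _ n])
    fix i
    have "emeasure M {\<omega>\<in>space M. \<omega> \<in> space (F n) \<and> W n \<omega> \<in> {..0} \<and> K n \<omega> = i \<and> B n \<omega> \<in> UNIV} = 0"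
      by (subst prob_renewal) (auto simp: measure_exponential_atMost_0)
    then show "emeasure M {\<omega>\<in>space M. W n \<omega> \<le> 0 \<and> K n \<omega> = i} = 0"
      by (simp add: space_F cong: conj_cong)
  qed measurable
  then show ?thesis by (simp add: not_le)
qed

end

locale tenable_polya_walk = polya_walk M F A x0 T K B X
  for M :: "'w measure" and F :: "nat \<Rightarrow> 'w measure"
    and A :: "'w \<Rightarrow> real^'c::finite^'c" and x0 :: "real^'c"
    and T :: "nat \<Rightarrow> 'w \<Rightarrow> real" and K :: "nat \<Rightarrow> 'w \<Rightarrow> 'c"
    and B :: "nat \<Rightarrow> 'w \<Rightarrow> real^'c^'c" and X :: "real \<Rightarrow> 'w \<Rightarrow> real^'c" +
  assumes tenable: "tenable M X"
begin

text \<open>Tenability concerns the positions \<open>X t\<close> at all times. It passes to the positions at the renewals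
  because every waiting time is positive, so that \<open>X\<close> really visits each of these positions.\<close>
lemma regular_paths:
  "AE \<omega> in M. T 0 \<omega> = 0 \<and> (\<forall>n. T n \<omega> < T (Suc n) \<omega>) \<and> filterlim (\<lambda>n. T n \<omega>) at_top sequentially
    \<and> (\<forall>n t. T n \<omega> \<le> t \<and> t < T (Suc n) \<omega> \<longrightarrow> X t \<omega> = Y n \<omega>)
    \<and> (\<forall>n. 0 < total (Y n \<omega>) \<and> (\<forall>i. 0 \<le> Y n \<omega> $ i))"
proof -
  have "AE \<omega> in M. \<forall>n. 0 < W n \<omega>" "AE \<omega> in M. \<forall>n. 0 < total (Y n \<omega>)"
    using waiting_time_pos total_pos by (auto simp: AE_all_countable)
  with T_0 renewals_finite X_path tenable[unfolded tenable_def] show ?thesis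
  proof eventually_elim
    case (elim \<omega>)
    have "0 \<le> T n \<omega>" for n
      using elim by (induction n) (auto simp: less_imp_le intro: order_trans)
    with elim show ?case
      by (metis diff_gt_0_iff_gt order_refl)
  qed
qed

section \<open>The law of a renewal given its history\<close>

text \<open>The joint density of the waiting time and the color \<open>i\<close>, given the history. For a positive
  rate and \<open>w \<ge> 0\<close> it equals \<open>Y n \<omega> $ i * exp (- total (Y n \<omega>) * w)\<close>.\<close>
definition waiting_density :: "nat \<Rightarrow> 'c \<Rightarrow> 'w \<Rightarrow> real \<Rightarrow> ennreal" where
  "waiting_density n i \<omega> w =
    ennreal (exponential_density (total (Y n \<omega>)) w) * ennreal (Y n \<omega> $ i / total (Y n \<omega>))"

lemma waiting_density_measurable [measurable]:
  "case_prod (waiting_density n i) \<in> borel_measurable (F n \<Otimes>\<^sub>M borel)"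
proof -
  note [measurable] = Y_measurable
  show ?thesis
    unfolding waiting_density_def exponential_density_def case_prod_beta by measurable
qed

lemma prob_renewal_density:
  assumes [measurable]: "G \<in> sets (F n)" and D[measurable]: "D \<in> sets borel" and S[measurable]: "S \<in> sets borel"
  shows "emeasure M {\<omega>\<in>space M. \<omega> \<in> G \<and> W n \<omega> \<in> D \<and> K n \<omega> = i \<and> B n \<omega> \<in> S} =
    (\<integral>\<^sup>+ \<omega>. (\<integral>\<^sup>+ w. waiting_density n i \<omega> w * indicator (G \<times> D) (\<omega>, w) \<partial>lborel) \<partial>M)
      * emeasure M {\<omega>\<in>space M. A \<omega> \<in> S}"
proof -
  let ?c = "prob {\<omega>\<in>space M. A \<omega> \<in> S}"
  have "emeasure M {\<omega>\<in>space M. \<omega> \<in> G \<and> W n \<omega> \<in> D \<and> K n \<omega> = i \<and> B n \<omega> \<in> S} =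
    (\<integral>\<^sup>+ \<omega>. (\<integral>\<^sup>+ w. waiting_density n i \<omega> w * indicator (G \<times> D) (\<omega>, w) \<partial>lborel) * ennreal ?c \<partial>M)"
    unfolding prob_renewal[OF assms]
  proof (rule nn_integral_cong_AE, use regular_paths in eventually_elim)
    case (elim \<omega>)
    then have *: "0 < total (Y n \<omega>)" "0 \<le> Y n \<omega> $ i" by auto
    have "(\<integral>\<^sup>+ w. waiting_density n i \<omega> w * indicator (G \<times> D) (\<omega>, w) \<partial>lborel) =
      (\<integral>\<^sup>+ w. ennreal (exponential_density (total (Y n \<omega>)) w) * indicator D w *
        (indicator G \<omega> * ennreal (Y n \<omega> $ i / total (Y n \<omega>))) \<partial>lborel)"
      by (intro nn_integral_cong) (auto simp: waiting_density_def indicator_def)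
    also have "\<dots> = ennreal (measure (density lborel (exponential_density (total (Y n \<omega>)))) D) *
        (indicator G \<omega> * ennreal (Y n \<omega> $ i / total (Y n \<omega>)))"
      using * by (subst nn_integral_multc) (auto simp: measure_exponential)
    moreover have split: "ennreal (m * (Y n \<omega> $ i / total (Y n \<omega>)) * ?c) =
        ennreal m * ennreal (Y n \<omega> $ i / total (Y n \<omega>)) * ennreal ?c" if "0 \<le> m" for m
      using * that by (subst ennreal_mult; (subst ennreal_mult)?) (auto simp: zero_le_mult_iff)
    ultimately show ?case
      unfolding split[OF measure_nonneg] by (simp only: mult_ac)
  qed
  also have "\<dots> = (\<integral>\<^sup>+ \<omega>. (\<integral>\<^sup>+ w. waiting_density n i \<omega> w * indicator (G \<times> D) (\<omega>, w) \<partial>lborel) \<partial>M)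
      * emeasure M {\<omega>\<in>space M. A \<omega> \<in> S}"
  proof (subst nn_integral_multc)
    have "(\<lambda>\<omega>. \<integral>\<^sup>+ w. waiting_density n i \<omega> w * indicator (G \<times> D) (\<omega>, w) \<partial>lborel) \<in> borel_measurable (F n)"
      by measurable
    then show "(\<lambda>\<omega>. \<integral>\<^sup>+ w. waiting_density n i \<omega> w * indicator (G \<times> D) (\<omega>, w) \<partial>lborel) \<in> borel_measurable M"
      by (rule measurable_history)
  qed (simp add: emeasure_eq_measure)
  finally show ?thesis .
qed

text \<open>Both sides are integrals of \<open>g\<close> with respect to measures on pairs of an outcome, seen through
  \<open>F n\<close>, and a waiting time. These agree on rectangles by \<open>prob_renewal_density\<close>, hence everywhere.\<close>
lemma renewal_integral_matrix_event:
  assumes g[measurable]: "case_prod g \<in> borel_measurable (F n \<Otimes>\<^sub>M borel)" and S[measurable]: "S \<in> sets borel"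
  shows "(\<integral>\<^sup>+ \<omega>. g \<omega> (W n \<omega>) * indicator {\<omega>\<in>space M. K n \<omega> = i \<and> B n \<omega> \<in> S} \<omega> \<partial>M) =
    (\<integral>\<^sup>+ \<omega>. (\<integral>\<^sup>+ w. g \<omega> w * waiting_density n i \<omega> w \<partial>lborel) \<partial>M) * emeasure M {\<omega>\<in>space M. A \<omega> \<in> S}"
proof -
  \<comment> \<open>The filtration only provides \<open>\<sigma>\<close>-algebras; \<open>N\<close> is the restriction of the probability to \<open>F n\<close>.\<close>
  define N where "N = restr_to_subalg M (F n)"
  have sets_N [measurable_cong]: "sets N = sets (F n)"
    unfolding N_def by (rule sets_restr_to_subalg[OF history])
  have space_N: "space N = space M" by (simp add: N_def space_restr_to_subalg)
  have int_N: "integral\<^sup>N N f = integral\<^sup>N M f" if "f \<in> borel_measurable (F n)" for f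
    unfolding N_def by (rule nn_integral_subalgebra2[OF history that])
  let ?E = "{\<omega>\<in>space M. K n \<omega> = i \<and> B n \<omega> \<in> S}"
  let ?c = "emeasure M {\<omega>\<in>space M. A \<omega> \<in> S}"
  let ?gen = "{G \<times> D | G D. G \<in> sets (F n) \<and> D \<in> sets (borel :: real measure)}"
  define \<mu> where "\<mu> = distr (density M (indicator ?E)) (F n \<Otimes>\<^sub>M borel) (\<lambda>\<omega>. (\<omega>, W n \<omega>))"
  define \<nu> where "\<nu> = density (N \<Otimes>\<^sub>M lborel) (\<lambda>z. waiting_density n i (fst z) (snd z) * ?c)"
  have [measurable]: "(\<lambda>\<omega>. \<omega>) \<in> measurable M (F n)"
    by (rule measurable_history[of _ n]) simp
  have emb [measurable]: "(\<lambda>\<omega>. (\<omega>, W n \<omega>)) \<in> measurable M (F n \<Otimes>\<^sub>M borel)"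
    by measurable
  have [measurable]: "?E \<in> sets M" by measurable
  have \<mu>_int: "integral\<^sup>N \<mu> (\<lambda>z. f (fst z) (snd z)) = (\<integral>\<^sup>+ \<omega>. indicator ?E \<omega> * f \<omega> (W n \<omega>) \<partial>M)"
    if [measurable]: "case_prod f \<in> borel_measurable (F n \<Otimes>\<^sub>M borel)" for f
    unfolding \<mu>_def
    by (subst nn_integral_distr) (simp_all add: nn_integral_density)
  have \<nu>_int: "integral\<^sup>N \<nu> (\<lambda>z. f (fst z) (snd z)) =
      (\<integral>\<^sup>+ \<omega>. (\<integral>\<^sup>+ w. f \<omega> w * waiting_density n i \<omega> w \<partial>lborel) \<partial>M) * ?c"
    if [measurable]: "case_prod f \<in> borel_measurable (F n \<Otimes>\<^sub>M borel)" for f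
  proof -
    have "integral\<^sup>N \<nu> (\<lambda>z. f (fst z) (snd z)) =
      (\<integral>\<^sup>+ z. (f (fst z) (snd z) * waiting_density n i (fst z) (snd z)) * ?c \<partial>(N \<Otimes>\<^sub>M lborel))"
      unfolding \<nu>_def by (subst nn_integral_density) (auto simp: mult_ac)
    also have "\<dots> = (\<integral>\<^sup>+ z. f (fst z) (snd z) * waiting_density n i (fst z) (snd z) \<partial>(N \<Otimes>\<^sub>M lborel)) * ?c"
      by (rule nn_integral_multc) measurable
    also have "(\<integral>\<^sup>+ z. f (fst z) (snd z) * waiting_density n i (fst z) (snd z) \<partial>(N \<Otimes>\<^sub>M lborel)) =
      (\<integral>\<^sup>+ \<omega>. (\<integral>\<^sup>+ w. f \<omega> w * waiting_density n i \<omega> w \<partial>lborel) \<partial>N)"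
      by (subst lborel.nn_integral_fst[symmetric]) (simp_all, measurable)
    also have "\<dots> = (\<integral>\<^sup>+ \<omega>. (\<integral>\<^sup>+ w. f \<omega> w * waiting_density n i \<omega> w \<partial>lborel) \<partial>M)"
      by (rule int_N) measurable
    finally show ?thesis .
  qed
  have "\<mu> = \<nu>"
  proof (rule measure_eqI_generator_eq[of ?gen "space (F n) \<times> UNIV"])
    show "Int_stable ?gen" by (rule Int_stable_pair_measure_generator)
    show "?gen \<subseteq> Pow (space (F n) \<times> UNIV)" using sets.sets_into_space by fastforce
    show "sets \<mu> = sigma_sets (space (F n) \<times> UNIV) ?gen"
      unfolding \<mu>_def by (simp add: sets_pair_measure)
    show "sets \<nu> = sigma_sets (space (F n) \<times> UNIV) ?gen"
      using sets_pair_measure_cong[OF sets_N sets_lborel] unfolding \<nu>_def by (simp add: sets_pair_measure)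
    show "range (\<lambda>_::nat. space (F n) \<times> (UNIV::real set)) \<subseteq> ?gen"
      using sets.top[of "F n"] by (auto intro!: exI[of _ "space (F n)"] exI[of _ "UNIV :: real set"])
    show "(\<Union>_::nat. space (F n) \<times> (UNIV::real set)) = space (F n) \<times> UNIV" by auto
    show "emeasure \<mu> (space (F n) \<times> (UNIV::real set)) \<noteq> \<infinity>" for j :: nat
    proof -
      have "space M \<times> UNIV \<in> sets (F n \<Otimes>\<^sub>M (borel :: real measure))"
        using sets.top[of "F n \<Otimes>\<^sub>M (borel :: real measure)"]
        by (simp add: space_pair_measure space_F)
      then have "emeasure \<mu> (space (F n) \<times> (UNIV::real set)) \<le> emeasure M (space M)"
        unfolding \<mu>_def
        by (subst emeasure_distr)
           (auto simp: emeasure_density indicator_inter_arith[symmetric] space_F intro!: emeasure_mono)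
      then show ?thesis by (auto simp: emeasure_space_1 top_unique)
    qed
    fix Z assume "Z \<in> ?gen"
    then obtain G D where Z: "Z = G \<times> D" and [measurable]: "G \<in> sets (F n)" "D \<in> sets (borel::real measure)"
      by auto
    have G: "G \<subseteq> space M" using sets.sets_into_space[of G "F n"] by (auto simp: space_F)
    have [measurable]: "Z \<in> sets (F n \<Otimes>\<^sub>M borel)" unfolding Z by measurable
    have Zi: "(\<lambda>(\<omega>, w). indicator Z (\<omega>, w) :: ennreal) \<in> borel_measurable (F n \<Otimes>\<^sub>M borel)"
      by (simp add: case_prod_beta)
    have "emeasure \<mu> Z = integral\<^sup>N \<mu> (indicator Z)"
      by (rule nn_integral_indicator[symmetric]) (simp add: \<mu>_def)
    also have "\<dots> = (\<integral>\<^sup>+ \<omega>. indicator ?E \<omega> * indicator Z (\<omega>, W n \<omega>) \<partial>M)"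
      using \<mu>_int[OF Zi] by simp
    also have "\<dots> = (\<integral>\<^sup>+ \<omega>. indicator {\<omega>\<in>space M. \<omega> \<in> G \<and> W n \<omega> \<in> D \<and> K n \<omega> = i \<and> B n \<omega> \<in> S} \<omega> \<partial>M)"
      by (intro nn_integral_cong) (auto simp: Z indicator_def)
    also have "\<dots> = emeasure M {\<omega>\<in>space M. \<omega> \<in> G \<and> W n \<omega> \<in> D \<and> K n \<omega> = i \<and> B n \<omega> \<in> S}"
    proof (rule nn_integral_indicator)
      have "G \<in> sets M" using history[of n] \<open>G \<in> sets (F n)\<close> by (auto simp: subalgebra_def)
      then show "{\<omega>\<in>space M. \<omega> \<in> G \<and> W n \<omega> \<in> D \<and> K n \<omega> = i \<and> B n \<omega> \<in> S} \<in> sets M" by measurable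
    qed
    also have "\<dots> = integral\<^sup>N \<nu> (indicator Z)"
      using \<nu>_int[OF Zi] by (simp add: prob_renewal_density Z mult.commute)
    also have "\<dots> = emeasure \<nu> Z"
      by (rule nn_integral_indicator) (simp add: \<nu>_def)
    finally show "emeasure \<mu> Z = emeasure \<nu> Z" .
  qed
  with \<mu>_int[OF g] \<nu>_int[OF g] show ?thesis by (simp add: mult.commute)
qed

text \<open>Integration against the conditional law of a renewal: the past and the waiting time enter through
  \<open>g\<close>, and the matrix factors out because it is independent of both and of the color. For fixed \<open>g\<close>
  the two sides are integrals of \<open>h\<close> with respect to proportional measures.\<close>
lemma renewal_integral:
  assumes g[measurable]: "case_prod g \<in> borel_measurable (F n \<Otimes>\<^sub>M borel)"
    and h[measurable]: "h \<in> borel_measurable borel"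
  shows "(\<integral>\<^sup>+ \<omega>. g \<omega> (W n \<omega>) * indicator {\<omega>. K n \<omega> = i} \<omega> * h (B n \<omega>) \<partial>M) =
    (\<integral>\<^sup>+ \<omega>. (\<integral>\<^sup>+ w. g \<omega> w * waiting_density n i \<omega> w \<partial>lborel) \<partial>M) * (\<integral>\<^sup>+ \<omega>. h (A \<omega>) \<partial>M)"
proof -
  let ?c = "\<integral>\<^sup>+ \<omega>. (\<integral>\<^sup>+ w. g \<omega> w * waiting_density n i \<omega> w \<partial>lborel) \<partial>M"
  let ?g = "\<lambda>\<omega>. g \<omega> (W n \<omega>) * indicator {\<omega>\<in>space M. K n \<omega> = i} \<omega>"
  have [measurable]: "(\<lambda>\<omega>. \<omega>) \<in> measurable M (F n)"
    by (rule measurable_history[of _ n]) simp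
  have [measurable]: "(\<lambda>\<omega>. g \<omega> (W n \<omega>)) \<in> borel_measurable M" by measurable
  have "distr (density M ?g) borel (B n) = scale_measure ?c (distr M borel A)"
  proof (rule measure_eqI)
    fix S assume "S \<in> sets (distr (density M ?g) borel (B n))"
    then have [measurable]: "S \<in> sets borel" by simp
    have "emeasure (distr (density M ?g) borel (B n)) S =
      (\<integral>\<^sup>+ \<omega>. g \<omega> (W n \<omega>) * indicator {\<omega>\<in>space M. K n \<omega> = i \<and> B n \<omega> \<in> S} \<omega> \<partial>M)"
      by (simp add: emeasure_distr emeasure_density)
         (auto intro!: nn_integral_cong simp: indicator_def)
    also have "\<dots> = ?c * emeasure M {\<omega>\<in>space M. A \<omega> \<in> S}"
      by (rule renewal_integral_matrix_event[OF g]) fact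
    also have "\<dots> = emeasure (scale_measure ?c (distr M borel A)) S"
      by (simp add: emeasure_distr vimage_def Int_def conj_commute)
    finally show "emeasure (distr (density M ?g) borel (B n)) S = emeasure (scale_measure ?c (distr M borel A)) S" .
  qed simp
  then have "integral\<^sup>N (distr (density M ?g) borel (B n)) h = integral\<^sup>N (scale_measure ?c (distr M borel A)) h"
    by simp
  moreover have "integral\<^sup>N (distr (density M ?g) borel (B n)) h =
      (\<integral>\<^sup>+ \<omega>. g \<omega> (W n \<omega>) * indicator {\<omega>. K n \<omega> = i} \<omega> * h (B n \<omega>) \<partial>M)"
    by (simp add: nn_integral_distr nn_integral_density) (auto intro!: nn_integral_cong simp: indicator_def)
  ultimately show ?thesis
    by (simp add: nn_integral_scale_measure nn_integral_distr)
qed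

text \<open>Summed over the colors, the waiting time is exponential.\<close>
lemma renewal_integral_all_colors:
  assumes g[measurable]: "case_prod g \<in> borel_measurable (F n \<Otimes>\<^sub>M borel)"
  shows "(\<integral>\<^sup>+ \<omega>. g \<omega> (W n \<omega>) \<partial>M) =
    (\<integral>\<^sup>+ \<omega>. (\<integral>\<^sup>+ w. g \<omega> w * ennreal (exponential_density (total (Y n \<omega>)) w) \<partial>lborel) \<partial>M)"
proof -
  note [measurable] = waiting_density_measurable
  have [measurable]: "(\<lambda>\<omega>. \<omega>) \<in> measurable M (F n)"
    by (rule measurable_history[of _ n]) simp
  have [measurable]: "(\<lambda>\<omega>. g \<omega> (W n \<omega>)) \<in> borel_measurable M" by measurable
  have "(\<integral>\<^sup>+ \<omega>. g \<omega> (W n \<omega>) \<partial>M) =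
      (\<integral>\<^sup>+ \<omega>. (\<Sum>i\<in>UNIV. g \<omega> (W n \<omega>) * indicator {\<omega>. K n \<omega> = i} \<omega>) \<partial>M)"
    by (intro nn_integral_cong) (simp add: indicator_def flip: sum_distrib_left)
  also have "\<dots> = (\<Sum>i\<in>UNIV. \<integral>\<^sup>+ \<omega>. g \<omega> (W n \<omega>) * indicator {\<omega>. K n \<omega> = i} \<omega> \<partial>M)"
    by (rule nn_integral_sum) measurable
  also have "\<dots> = (\<Sum>i\<in>UNIV. \<integral>\<^sup>+ \<omega>. (\<integral>\<^sup>+ w. g \<omega> w * waiting_density n i \<omega> w \<partial>lborel) \<partial>M)"
    using renewal_integral[OF g, of "\<lambda>_. 1"] by (simp add: emeasure_space_1)
  also have "\<dots> = (\<integral>\<^sup>+ \<omega>. (\<Sum>i\<in>UNIV. \<integral>\<^sup>+ w. g \<omega> w * waiting_density n i \<omega> w \<partial>lborel) \<partial>M)"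
  proof (rule nn_integral_sum[symmetric])
    fix i
    show "(\<lambda>\<omega>. \<integral>\<^sup>+ w. g \<omega> w * waiting_density n i \<omega> w \<partial>lborel) \<in> borel_measurable M"
      by (rule measurable_history[of _ n]) measurable
  qed
  also have "\<dots> = (\<integral>\<^sup>+ \<omega>. (\<integral>\<^sup>+ w. g \<omega> w * ennreal (exponential_density (total (Y n \<omega>)) w) \<partial>lborel) \<partial>M)"
  proof (rule nn_integral_cong_AE, use regular_paths AE_space in eventually_elim)
    case (elim \<omega>)
    then have pos: "0 < total (Y n \<omega>)" "\<And>i. 0 \<le> Y n \<omega> $ i"
      and [measurable]: "\<omega> \<in> space (F n)" by (auto simp: space_F)
    have "(\<Sum>i\<in>UNIV. ennreal (Y n \<omega> $ i / total (Y n \<omega>))) = ennreal (\<Sum>i\<in>UNIV. Y n \<omega> $ i / total (Y n \<omega>))"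
      using pos by (intro sum_ennreal) auto
    also have "(\<Sum>i\<in>UNIV. Y n \<omega> $ i / total (Y n \<omega>)) = 1"
      using pos by (simp add: total_def flip: sum_divide_distrib)
    finally have one: "(\<Sum>i\<in>UNIV. ennreal (Y n \<omega> $ i / total (Y n \<omega>))) = 1" by simp
    have "(\<Sum>i\<in>UNIV. \<integral>\<^sup>+ w. g \<omega> w * waiting_density n i \<omega> w \<partial>lborel) =
      (\<integral>\<^sup>+ w. (\<Sum>i\<in>UNIV. g \<omega> w * waiting_density n i \<omega> w) \<partial>lborel)"
      by (rule nn_integral_sum[symmetric]) measurable
    also have "\<dots> = (\<integral>\<^sup>+ w. g \<omega> w * ennreal (exponential_density (total (Y n \<omega>)) w) \<partial>lborel)"
      by (simp add: waiting_density_def one flip: sum_distrib_left)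
    finally show ?case .
  qed
  finally show ?thesis .
qed

section \<open>The state at a fixed time\<close>

text \<open>Given the history, the probability that the next renewal has not occurred by time \<open>c\<close> is the tail
  of the exponential distribution.\<close>
lemma survival:
  assumes [measurable]: "H \<in> borel_measurable (F n)"
  shows "(\<integral>\<^sup>+ \<omega>. (if T n \<omega> \<le> c \<and> c < T (Suc n) \<omega> then H \<omega> else 0) \<partial>M) =
    (\<integral>\<^sup>+ \<omega>. (if T n \<omega> \<le> c then H \<omega> * ennreal (exp (- total (Y n \<omega>) * (c - T n \<omega>))) else 0) \<partial>M)"
proof -
  note [measurable] = Y_measurable T_measurable
  let ?g = "\<lambda>\<omega> w. if T n \<omega> \<le> c \<and> c < T n \<omega> + w then H \<omega> else 0"
  have "(\<integral>\<^sup>+ \<omega>. (if T n \<omega> \<le> c \<and> c < T (Suc n) \<omega> then H \<omega> else 0) \<partial>M) = (\<integral>\<^sup>+ \<omega>. ?g \<omega> (W n \<omega>) \<partial>M)"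
    by simp
  also have "\<dots> = (\<integral>\<^sup>+ \<omega>. (\<integral>\<^sup>+ w. ?g \<omega> w * ennreal (exponential_density (total (Y n \<omega>)) w) \<partial>lborel) \<partial>M)"
    by (rule renewal_integral_all_colors) measurable
  also have "\<dots> = (\<integral>\<^sup>+ \<omega>. (if T n \<omega> \<le> c then H \<omega> * ennreal (exp (- total (Y n \<omega>) * (c - T n \<omega>))) else 0) \<partial>M)"
  proof (rule nn_integral_cong_AE, use regular_paths in eventually_elim)
    case (elim \<omega>)
    show ?case
    proof (cases "T n \<omega> \<le> c")
      case True
      have "(\<integral>\<^sup>+ w. ?g \<omega> w * ennreal (exponential_density (total (Y n \<omega>)) w) \<partial>lborel) =
        (\<integral>\<^sup>+ w. H \<omega> * (ennreal (exponential_density (total (Y n \<omega>)) w) * indicator {c - T n \<omega><..} w) \<partial>lborel)"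
        using True by (intro nn_integral_cong) (auto simp: indicator_def)
      also have "\<dots> = H \<omega> * ennreal (exp (- total (Y n \<omega>) * (c - T n \<omega>)))"
        using True elim by (subst nn_integral_cmult) (auto simp: exponential_tail)
      finally show ?thesis using True by simp
    qed simp
  qed
  finally show ?thesis .
qed

text \<open>\<open>m\<close> is the number of renewals up to time \<open>r\<close>.\<close>
lemma unique_epoch:
  assumes "T 0 \<omega> = 0" "\<And>n. T n \<omega> < T (Suc n) \<omega>" "filterlim (\<lambda>n. T n \<omega>) at_top sequentially" "0 \<le> r"
  obtains m where "\<And>n. T n \<omega> \<le> r \<and> r < T (Suc n) \<omega> \<longleftrightarrow> n = m"
proof -
  have mono: "strict_mono (\<lambda>n. T n \<omega>)"
    using assms(2) by (rule strict_monoI_Suc)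
  have "eventually (\<lambda>n. r < T n \<omega>) sequentially"
    using assms(3) by (auto simp: filterlim_at_top_dense)
  then obtain k where k: "r < T k \<omega>"
    by (auto simp: eventually_sequentially)
  define m where "m = (GREATEST n. T n \<omega> \<le> r)"
  have bound: "n \<le> k" if "T n \<omega> \<le> r" for n
    using that k strict_mono_less[OF mono, of n k] by linarith
  have m: "T m \<omega> \<le> r"
    unfolding m_def using GreatestI_nat[of "\<lambda>n. T n \<omega> \<le> r" 0 k] assms(1,4) bound by auto
  have max: "n \<le> m" if "T n \<omega> \<le> r" for n
    unfolding m_def using Greatest_le_nat[of "\<lambda>n. T n \<omega> \<le> r" n k] that bound by auto
  have "T n \<omega> \<le> r \<and> r < T (Suc n) \<omega> \<longleftrightarrow> n = m" for n
  proof
    assume n: "T n \<omega> \<le> r \<and> r < T (Suc n) \<omega>"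
    then have "T m \<omega> < T (Suc n) \<omega>" using m by linarith
    then have "m < Suc n" using strict_mono_less[OF mono] by auto
    with max[of n] n show "n = m" by linarith
  next
    assume "n = m"
    then show "T n \<omega> \<le> r \<and> r < T (Suc n) \<omega>"
      using m max[of "Suc m"] by fastforce
  qed
  then show thesis by (rule that)
qed

lemma state_eq_suminf:
  fixes q :: "real^'c \<Rightarrow> ennreal"
  assumes "0 \<le> r"
  shows "AE \<omega> in M. q (X r \<omega>) = (\<Sum>n. if T n \<omega> \<le> r \<and> r < T (Suc n) \<omega> then q (Y n \<omega>) else 0)"
  using regular_paths
proof eventually_elim
  case (elim \<omega>)
  with assms obtain m where m: "\<And>n. T n \<omega> \<le> r \<and> r < T (Suc n) \<omega> \<longleftrightarrow> n = m"
    using unique_epoch by metis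
  then have "X r \<omega> = Y m \<omega>" using elim by blast
  moreover have "(\<Sum>n. if T n \<omega> \<le> r \<and> r < T (Suc n) \<omega> then q (Y n \<omega>) else 0) = q (Y m \<omega>)"
    unfolding m using sums_single[of m "\<lambda>n. q (Y n \<omega>)"] by (simp add: sums_iff)
  ultimately show ?case by simp
qed

text \<open>The state at time \<open>r\<close> is \<open>Y n\<close> on the event that \<open>r\<close> lies between the renewals \<open>n\<close> and \<open>n + 1\<close>,
  whose conditional probability is given by \<open>survival\<close>.\<close>
lemma state_expectation:
  fixes q :: "real^'c \<Rightarrow> ennreal"
  assumes "0 \<le> r" and [measurable]: "q \<in> borel_measurable borel"
  shows "(\<integral>\<^sup>+ \<omega>. q (X r \<omega>) \<partial>M) =
    (\<Sum>n. \<integral>\<^sup>+ \<omega>. (if T n \<omega> \<le> r then q (Y n \<omega>) * ennreal (exp (- total (Y n \<omega>) * (r - T n \<omega>))) else 0) \<partial>M)"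
proof -
  note [measurable] = Y_measurable
  have "(\<integral>\<^sup>+ \<omega>. q (X r \<omega>) \<partial>M) =
    (\<integral>\<^sup>+ \<omega>. (\<Sum>n. if T n \<omega> \<le> r \<and> r < T (Suc n) \<omega> then q (Y n \<omega>) else 0) \<partial>M)"
    by (intro nn_integral_cong_AE state_eq_suminf assms)
  also have "\<dots> = (\<Sum>n. \<integral>\<^sup>+ \<omega>. (if T n \<omega> \<le> r \<and> r < T (Suc n) \<omega> then q (Y n \<omega>) else 0) \<partial>M)"
    by (rule nn_integral_suminf) measurable
  also have "\<dots> = (\<Sum>n. \<integral>\<^sup>+ \<omega>. (if T n \<omega> \<le> r then q (Y n \<omega>) * ennreal (exp (- total (Y n \<omega>) * (r - T n \<omega>))) else 0) \<partial>M)"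
    by (subst survival) measurable
  finally show ?thesis .
qed

text \<open>The left-hand side is the expectation of \<open>q (X (r + d))\<close> restricted to the event that no renewal
  occurs in \<open>]r, r + d]\<close>. In terms of \<open>state_expectation\<close>, the factor \<open>exp (- total x * d)\<close> turns the
  survival probability up to \<open>r\<close> into the one up to \<open>r + d\<close>, and the restriction \<open>T n \<le> r\<close> is weaker
  at the later time.\<close>
lemma no_renewal_bound:
  fixes q :: "real^'c \<Rightarrow> ennreal"
  assumes "0 \<le> r" "0 \<le> d" and [measurable]: "q \<in> borel_measurable borel"
  shows "(\<integral>\<^sup>+ \<omega>. q (X r \<omega>) * ennreal (exp (- total (X r \<omega>) * d)) \<partial>M) \<le> (\<integral>\<^sup>+ \<omega>. q (X (r + d) \<omega>) \<partial>M)"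
proof -
  have rd: "0 \<le> r + d" using assms by simp
  let ?q = "\<lambda>x. q x * ennreal (exp (- total x * d))"
  let ?L = "\<lambda>n \<omega>. if T n \<omega> \<le> r then ?q (Y n \<omega>) * ennreal (exp (- total (Y n \<omega>) * (r - T n \<omega>))) else 0"
  let ?R = "\<lambda>n \<omega>. if T n \<omega> \<le> r + d then q (Y n \<omega>) * ennreal (exp (- total (Y n \<omega>) * (r + d - T n \<omega>))) else 0"
  have q_meas: "?q \<in> borel_measurable borel" by measurable
  have "?L n \<omega> \<le> ?R n \<omega>" for n \<omega>
  proof (cases "T n \<omega> \<le> r")
    case True
    have "?q (Y n \<omega>) * ennreal (exp (- total (Y n \<omega>) * (r - T n \<omega>))) =
      q (Y n \<omega>) * ennreal (exp (- total (Y n \<omega>) * (r + d - T n \<omega>)))"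
      by (simp add: mult.assoc exp_add[symmetric] algebra_simps flip: ennreal_mult)
    then show ?thesis using True assms(2) by simp
  qed simp
  then have "(\<Sum>n. integral\<^sup>N M (?L n)) \<le> (\<Sum>n. integral\<^sup>N M (?R n))"
    by (intro suminf_le nn_integral_mono) auto
  then show ?thesis
    unfolding state_expectation[OF rd assms(3)] state_expectation[OF assms(1) q_meas] .
qed

section \<open>Sums over renewals\<close>

text \<open>Renewals of color \<open>i\<close> occur at rate \<open>X r $ i\<close>. For the renewal number \<open>n + 1\<close>, the density of its
  time at \<open>r\<close> together with the color \<open>i\<close> is \<open>Y n $ i * exp (- total (Y n) * (r - T n))\<close> by
  \<open>renewal_integral\<close>; by \<open>survival\<close>, the exponential is also the conditional probability that the
  walk still is in the state \<open>Y n\<close> at time \<open>r\<close>. Summing over \<open>n\<close> gives the state at time \<open>r\<close>.\<close>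
lemma renewal_intensity:
  fixes q :: "real^'c \<Rightarrow> ennreal"
  assumes a: "0 \<le> a" and [measurable]: "q \<in> borel_measurable borel" "h \<in> borel_measurable borel"
  shows "(\<integral>\<^sup>+ \<omega>. (\<Sum>n. (if a < T (Suc n) \<omega> \<and> T (Suc n) \<omega> \<le> b then q (Y n \<omega>) else 0) *
        indicator {\<omega>. K n \<omega> = i} \<omega> * h (B n \<omega>)) \<partial>M) =
    (\<integral>\<^sup>+ r. (\<integral>\<^sup>+ \<omega>. ennreal (X r \<omega> $ i) * q (X r \<omega>) \<partial>M) * indicator {a..b} r \<partial>lborel) * (\<integral>\<^sup>+ \<omega>. h (A \<omega>) \<partial>M)"
proof -
  interpret P: pair_sigma_finite lborel M ..
  note [measurable] = Y_measurable T_measurable waiting_density_measurable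
  let ?surv = "\<lambda>n r \<omega>. if T n \<omega> \<le> r then (ennreal (Y n \<omega> $ i) * q (Y n \<omega>)) *
      ennreal (exp (- total (Y n \<omega>) * (r - T n \<omega>))) else 0"
  let ?g = "\<lambda>n \<omega> w. if a < T n \<omega> + w \<and> T n \<omega> + w \<le> b then q (Y n \<omega>) else 0"
  have step: "(\<integral>\<^sup>+ \<omega>. ?g n \<omega> (W n \<omega>) * indicator {\<omega>. K n \<omega> = i} \<omega> * h (B n \<omega>) \<partial>M) =
     (\<integral>\<^sup>+ r. (\<integral>\<^sup>+ \<omega>. ?surv n r \<omega> \<partial>M) * indicator {a..b} r \<partial>lborel) * (\<integral>\<^sup>+ \<omega>. h (A \<omega>) \<partial>M)" for n
  proof -
    have "(\<integral>\<^sup>+ \<omega>. ?g n \<omega> (W n \<omega>) * indicator {\<omega>. K n \<omega> = i} \<omega> * h (B n \<omega>) \<partial>M) =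
      (\<integral>\<^sup>+ \<omega>. (\<integral>\<^sup>+ w. ?g n \<omega> w * waiting_density n i \<omega> w \<partial>lborel) \<partial>M) * (\<integral>\<^sup>+ \<omega>. h (A \<omega>) \<partial>M)"
      by (rule renewal_integral) measurable
    also have "(\<integral>\<^sup>+ \<omega>. (\<integral>\<^sup>+ w. ?g n \<omega> w * waiting_density n i \<omega> w \<partial>lborel) \<partial>M) =
      (\<integral>\<^sup>+ \<omega>. (\<integral>\<^sup>+ r. ?surv n r \<omega> * indicator {a..b} r \<partial>lborel) \<partial>M)"
    proof (rule nn_integral_cong_AE, use regular_paths AE_space in eventually_elim)
      case (elim \<omega>)
      then have [measurable]: "\<omega> \<in> space (F n)" and pos: "0 < total (Y n \<omega>)" "0 \<le> Y n \<omega> $ i"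
        by (auto simp: space_F)
      \<comment> \<open>The renewal time \<open>r = T n \<omega> + w\<close> replaces the waiting time as variable of integration.\<close>
      have "(\<integral>\<^sup>+ w. ?g n \<omega> w * waiting_density n i \<omega> w \<partial>lborel) =
        (\<integral>\<^sup>+ r. ?g n \<omega> (- T n \<omega> + 1 * r) * waiting_density n i \<omega> (- T n \<omega> + 1 * r) \<partial>lborel)"
        by (subst nn_integral_real_affine[where c=1 and t="- T n \<omega>"]) (simp_all, measurable)
      \<comment> \<open>The window \<open>]a, b]\<close> and the interval \<open>[a, b]\<close> of integration differ by the null set \<open>{a}\<close>.\<close>
      also have "\<dots> = (\<integral>\<^sup>+ r. ?surv n r \<omega> * indicator {a..b} r \<partial>lborel)"
      proof (rule nn_integral_cong_AE, use AE_lborel_singleton[of a] in eventually_elim)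
        case (elim r)
        show ?case
        proof (cases "T n \<omega> \<le> r \<and> a < r \<and> r \<le> b")
          case True
          have "waiting_density n i \<omega> (- T n \<omega> + 1 * r) =
              ennreal (total (Y n \<omega>) * exp (- total (Y n \<omega>) * (r - T n \<omega>)) * (Y n \<omega> $ i / total (Y n \<omega>)))"
            unfolding waiting_density_def using True pos
            by (subst ennreal_mult[symmetric]) (auto simp: exponential_density_def algebra_simps)
          also have "\<dots> = ennreal (Y n \<omega> $ i * exp (- total (Y n \<omega>) * (r - T n \<omega>)))"
            using pos by simp
          also have "\<dots> = ennreal (Y n \<omega> $ i) * ennreal (exp (- total (Y n \<omega>) * (r - T n \<omega>)))"
            using pos by (simp add: ennreal_mult)
          finally show ?thesis using True by (simp add: mult_ac)
        qed (use elim in \<open>auto simp: waiting_density_def exponential_density_def\<close>)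
      qed
      finally show ?case .
    qed
    also have "\<dots> = (\<integral>\<^sup>+ r. (\<integral>\<^sup>+ \<omega>. ?surv n r \<omega> * indicator {a..b} r \<partial>M) \<partial>lborel)"
      by (rule P.Fubini') measurable
    also have "\<dots> = (\<integral>\<^sup>+ r. (\<integral>\<^sup>+ \<omega>. ?surv n r \<omega> \<partial>M) * indicator {a..b} r \<partial>lborel)"
      by (subst nn_integral_multc) (simp_all, measurable)
    finally show ?thesis .
  qed
  have "(\<integral>\<^sup>+ \<omega>. (\<Sum>n. ?g n \<omega> (W n \<omega>) * indicator {\<omega>. K n \<omega> = i} \<omega> * h (B n \<omega>)) \<partial>M) =
    (\<Sum>n. \<integral>\<^sup>+ \<omega>. ?g n \<omega> (W n \<omega>) * indicator {\<omega>. K n \<omega> = i} \<omega> * h (B n \<omega>) \<partial>M)"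
    by (rule nn_integral_suminf) measurable
  also have "\<dots> = (\<Sum>n. (\<integral>\<^sup>+ r. (\<integral>\<^sup>+ \<omega>. ?surv n r \<omega> \<partial>M) * indicator {a..b} r \<partial>lborel)) * (\<integral>\<^sup>+ \<omega>. h (A \<omega>) \<partial>M)"
    unfolding step by (rule ennreal_suminf_multc)
  also have "(\<Sum>n. (\<integral>\<^sup>+ r. (\<integral>\<^sup>+ \<omega>. ?surv n r \<omega> \<partial>M) * indicator {a..b} r \<partial>lborel)) =
    (\<integral>\<^sup>+ r. (\<Sum>n. (\<integral>\<^sup>+ \<omega>. ?surv n r \<omega> \<partial>M) * indicator {a..b} r) \<partial>lborel)"
    by (rule nn_integral_suminf[symmetric]) measurable
  also have "\<dots> = (\<integral>\<^sup>+ r. (\<integral>\<^sup>+ \<omega>. ennreal (X r \<omega> $ i) * q (X r \<omega>) \<partial>M) * indicator {a..b} r \<partial>lborel)"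
  proof (rule nn_integral_cong)
    fix r :: real
    show "(\<Sum>n. (\<integral>\<^sup>+ \<omega>. ?surv n r \<omega> \<partial>M) * indicator {a..b} r) =
      (\<integral>\<^sup>+ \<omega>. ennreal (X r \<omega> $ i) * q (X r \<omega>) \<partial>M) * indicator {a..b} r"
      using a state_expectation[of r "\<lambda>x. ennreal (x $ i) * q x"]
      by (cases "r \<in> {a..b}") simp_all
  qed
  finally show ?thesis by simp
qed

text \<open>The two sums have finitely many nonzero terms. They are written additively on both sides because the values of \<open>f\<close> are
  extended nonnegative numbers, where differences do not cancel.\<close>
lemma telescope:
  fixes f :: "real^'c \<Rightarrow> ennreal"
  assumes "0 \<le> a" "a \<le> b"
  shows "AE \<omega> in M.
      f (X b \<omega>) + (\<Sum>n. if a < T (Suc n) \<omega> \<and> T (Suc n) \<omega> \<le> b then f (Y n \<omega>) else 0) =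
      f (X a \<omega>) + (\<Sum>n. if a < T (Suc n) \<omega> \<and> T (Suc n) \<omega> \<le> b then f (Y (Suc n) \<omega>) else 0)"
  using regular_paths
proof eventually_elim
  case (elim \<omega>)
  then have mono: "strict_mono (\<lambda>n. T n \<omega>)"
    by (intro strict_monoI_Suc) auto
  obtain p where p: "\<And>n. T n \<omega> \<le> a \<and> a < T (Suc n) \<omega> \<longleftrightarrow> n = p"
    using elim assms unique_epoch by metis
  obtain m where m: "\<And>n. T n \<omega> \<le> b \<and> b < T (Suc n) \<omega> \<longleftrightarrow> n = m"
    using elim assms unique_epoch[of \<omega> b] by (metis order_trans)
  have p': "T p \<omega> \<le> a" "a < T (Suc p) \<omega>" and m': "T m \<omega> \<le> b" "b < T (Suc m) \<omega>"
    using p m by blast+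
  have lt: "a < T (Suc n) \<omega> \<longleftrightarrow> p \<le> n" for n
    using p' strict_mono_less[OF mono, of p "Suc n"] strict_mono_less_eq[OF mono, of "Suc p" "Suc n"]
      strict_mono_less_eq[OF mono, of "Suc n" p] by fastforce
  have le: "T (Suc n) \<omega> \<le> b \<longleftrightarrow> n < m" for n
    using m' strict_mono_less[OF mono, of "Suc n" "Suc m"] strict_mono_less_eq[OF mono, of "Suc n" m]
    by fastforce
  have "p \<le> m"
    using p' m' assms strict_mono_less[OF mono, of p "Suc m"] by linarith
  have sum: "(\<Sum>n. if a < T (Suc n) \<omega> \<and> T (Suc n) \<omega> \<le> b then u n else 0) = sum u {p..<m}"
    for u :: "nat \<Rightarrow> ennreal"
    unfolding lt le by (subst suminf_finite[of "{p..<m}"]) auto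
  have "f (Y m \<omega>) + (\<Sum>n\<in>{p..<m}. f (Y n \<omega>)) = f (Y p \<omega>) + (\<Sum>n\<in>{p..<m}. f (Y (Suc n) \<omega>))"
    using \<open>p \<le> m\<close>
  proof (induction m rule: dec_induct)
    case (step k)
    have "f (Y (Suc k) \<omega>) + (\<Sum>n\<in>{p..<Suc k}. f (Y n \<omega>)) =
        f (Y (Suc k) \<omega>) + (f (Y k \<omega>) + (\<Sum>n\<in>{p..<k}. f (Y n \<omega>)))"
      using step.hyps by (simp only: sum.atLeastLessThan_Suc add.commute)
    also have "\<dots> = f (Y p \<omega>) + ((\<Sum>n\<in>{p..<k}. f (Y (Suc n) \<omega>)) + f (Y (Suc k) \<omega>))"
      unfolding step.IH by (simp only: add_ac)
    also have "\<dots> = f (Y p \<omega>) + (\<Sum>n\<in>{p..<Suc k}. f (Y (Suc n) \<omega>))"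
      using step.hyps by (simp only: sum.atLeastLessThan_Suc)
    finally show ?case .
  qed simp
  moreover have "X a \<omega> = Y p \<omega>" "X b \<omega> = Y m \<omega>"
    using elim p' m' by blast+
  ultimately show ?case unfolding sum by simp
qed

end

section \<open>Derivatives of exponential moments\<close>

lemma abs_exp_minus_one_le: "\<bar>exp y - 1\<bar> \<le> \<bar>y\<bar> * exp \<bar>y\<bar>" for y :: real
proof (cases "0 \<le> y")
  case True
  have "1 - exp (- y) \<le> y"
    using exp_ge_add_one_self[of "- y"] by simp
  from mult_right_mono[OF this, of "exp y"] True show ?thesis
    by (simp add: left_diff_distrib flip: exp_add)
next
  case False
  have "1 - exp y \<le> - y * 1"
    using exp_ge_add_one_self[of y] by linarith
  also have "\<dots> \<le> - y * exp (- y)"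
    using False by (intro mult_left_mono) auto
  finally show ?thesis using False by simp
qed

lemma exp_difference_quotient_bound:
  fixes h U \<delta> :: real
  assumes "h \<noteq> 0" "\<bar>h\<bar> \<le> \<delta> / 2" "0 < \<delta>"
  shows "\<bar>(exp (h * U) - 1) / h\<bar> \<le> 2 / \<delta> * (exp (\<delta> * U) + exp (- \<delta> * U))"
proof -
  have "\<bar>(exp (h * U) - 1) / h\<bar> \<le> \<bar>h * U\<bar> * exp \<bar>h * U\<bar> / \<bar>h\<bar>"
    unfolding abs_divide by (intro divide_right_mono abs_exp_minus_one_le) simp
  also have "\<dots> = \<bar>U\<bar> * exp (\<bar>h\<bar> * \<bar>U\<bar>)"
    using assms by (simp add: abs_mult)
  also have "\<dots> \<le> \<bar>U\<bar> * exp (\<delta> / 2 * \<bar>U\<bar>)"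
    using mult_right_mono[OF assms(2), of "\<bar>U\<bar>"] by (intro mult_left_mono) auto
  also have "\<dots> \<le> (2 / \<delta> * exp (\<delta> / 2 * \<bar>U\<bar>)) * exp (\<delta> / 2 * \<bar>U\<bar>)"
  proof (rule mult_right_mono)
    have "\<delta> / 2 * \<bar>U\<bar> \<le> exp (\<delta> / 2 * \<bar>U\<bar>)"
      using exp_ge_add_one_self[of "\<delta> / 2 * \<bar>U\<bar>"] by linarith
    then show "\<bar>U\<bar> \<le> 2 / \<delta> * exp (\<delta> / 2 * \<bar>U\<bar>)"
      using assms by (simp add: field_simps)
  qed simp
  also have "\<dots> = 2 / \<delta> * exp (\<delta> * \<bar>U\<bar>)"
    by (simp flip: exp_add)
  also have "\<dots> \<le> 2 / \<delta> * (exp (\<delta> * U) + exp (- \<delta> * U))"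
    using assms by (intro mult_left_mono) (auto simp: abs_if)
  finally show ?thesis .
qed

text \<open>Dominated convergence for the difference quotients: two exponential moments, on either side of \<open>0\<close>,
  dominate all quotients with \<open>\<bar>h\<bar> \<le> \<delta> / 2\<close>.\<close>
lemma has_derivative_exponential_moment:
  fixes V U :: "'a \<Rightarrow> real"
  assumes [measurable]: "V \<in> borel_measurable M" "U \<in> borel_measurable M" and \<delta>: "0 < \<delta>"
    and plus: "integrable M (\<lambda>\<omega>. exp (V \<omega> + \<delta> * U \<omega>))"
    and minus: "integrable M (\<lambda>\<omega>. exp (V \<omega> - \<delta> * U \<omega>))"
  shows "((\<lambda>h. \<integral>\<omega>. exp (V \<omega> + h * U \<omega>) \<partial>M) has_real_derivative (\<integral>\<omega>. U \<omega> * exp (V \<omega>) \<partial>M)) (at 0)"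
proof -
  define D where "D \<omega> = exp (V \<omega> + \<delta> * U \<omega>) + exp (V \<omega> - \<delta> * U \<omega>)" for \<omega>
  have D: "integrable M D"
    unfolding D_def using plus minus by (rule Bochner_Integration.integrable_add)
  have D_eq: "exp (V \<omega>) * (exp (\<delta> * U \<omega>) + exp (- \<delta> * U \<omega>)) = D \<omega>" for \<omega>
    by (simp add: D_def distrib_left exp_diff exp_minus exp_add field_simps)
  have quot: "\<bar>(exp (V \<omega> + h * U \<omega>) - exp (V \<omega>)) / h\<bar> \<le> 2 / \<delta> * D \<omega>" if "h \<noteq> 0" "\<bar>h\<bar> \<le> \<delta> / 2" for h \<omega>
  proof -
    have "(exp (V \<omega> + h * U \<omega>) - exp (V \<omega>)) / h = exp (V \<omega>) * ((exp (h * U \<omega>) - 1) / h)"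
      by (simp add: exp_add right_diff_distrib)
    then have "\<bar>(exp (V \<omega> + h * U \<omega>) - exp (V \<omega>)) / h\<bar> = exp (V \<omega>) * \<bar>(exp (h * U \<omega>) - 1) / h\<bar>"
      by (simp only: abs_mult abs_exp_cancel)
    also have "\<dots> \<le> exp (V \<omega>) * (2 / \<delta> * (exp (\<delta> * U \<omega>) + exp (- \<delta> * U \<omega>)))"
      using exp_difference_quotient_bound[OF that \<delta>] by (intro mult_left_mono) auto
    also have "\<dots> = 2 / \<delta> * D \<omega>"
      by (simp flip: D_eq)
    finally show ?thesis .
  qed
  have lim: "((\<lambda>h. (exp (V \<omega> + h * U \<omega>) - exp (V \<omega>)) / h) \<longlongrightarrow> U \<omega> * exp (V \<omega>)) (at 0)" for \<omega>
  proof -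
    have "((\<lambda>h. exp (V \<omega> + h * U \<omega>)) has_real_derivative U \<omega> * exp (V \<omega>)) (at 0)"
      by (auto intro!: derivative_eq_intros)
    then show ?thesis by (simp add: has_field_derivative_iff)
  qed
  have int: "integrable M (\<lambda>\<omega>. exp (V \<omega> + h * U \<omega>))" if "\<bar>h\<bar> \<le> \<delta>" for h
  proof (rule Bochner_Integration.integrable_bound[OF D])
    have "exp (V \<omega> + h * U \<omega>) \<le> D \<omega>" for \<omega>
    proof -
      have "h * U \<omega> \<le> \<bar>h\<bar> * \<bar>U \<omega>\<bar>" by (simp flip: abs_mult)
      also have "\<dots> \<le> \<delta> * \<bar>U \<omega>\<bar>" using that by (intro mult_right_mono) auto
      finally have "exp (V \<omega> + h * U \<omega>) \<le> exp (V \<omega> + \<delta> * \<bar>U \<omega>\<bar>)" by simp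
      also have "\<dots> \<le> D \<omega>" by (auto simp: D_def abs_if)
      finally show ?thesis .
    qed
    then show "AE \<omega> in M. norm (exp (V \<omega> + h * U \<omega>)) \<le> norm (D \<omega>)"
      by (auto intro: order_trans[OF _ abs_ge_self])
  qed measurable
  have dom: "(\<lambda>k. \<integral>\<omega>. (exp (V \<omega> + H k * U \<omega>) - exp (V \<omega>)) / H k \<partial>M) \<longlonglongrightarrow> (\<integral>\<omega>. U \<omega> * exp (V \<omega>) \<partial>M)"
    if H: "\<And>k. H k \<noteq> 0" "H \<longlonglongrightarrow> 0" "\<And>k. \<bar>H k\<bar> \<le> \<delta> / 2" for H :: "nat \<Rightarrow> real"
  proof -
    have at: "filterlim H (at 0) sequentially"
      using H by (simp add: filterlim_at)
    have pt: "AE \<omega> in M. (\<lambda>k. (exp (V \<omega> + H k * U \<omega>) - exp (V \<omega>)) / H k) \<longlonglongrightarrow> U \<omega> * exp (V \<omega>)"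
      using filterlim_compose[OF lim at] by simp
    have bd: "AE \<omega> in M. norm ((exp (V \<omega> + H k * U \<omega>) - exp (V \<omega>)) / H k) \<le> 2 / \<delta> * D \<omega>" for k
      using quot H by simp
    have D': "integrable M (\<lambda>\<omega>. 2 / \<delta> * D \<omega>)" using D by simp
    have m: "(\<lambda>\<omega>. U \<omega> * exp (V \<omega>)) \<in> borel_measurable M"
      "(\<lambda>\<omega>. (exp (V \<omega> + H k * U \<omega>) - exp (V \<omega>)) / H k) \<in> borel_measurable M" for k
      by measurable
    show ?thesis
      by (rule integral_dominated_convergence[OF m D' pt bd])
  qed
  show "((\<lambda>h. \<integral>\<omega>. exp (V \<omega> + h * U \<omega>) \<partial>M) has_real_derivative (\<integral>\<omega>. U \<omega> * exp (V \<omega>) \<partial>M)) (at 0)"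
    unfolding has_field_derivative_iff tendsto_at_iff_sequentially comp_def
  proof (intro allI impI)
    fix H :: "nat \<Rightarrow> real" assume H: "\<forall>k. H k \<in> UNIV - {0}" "H \<longlonglongrightarrow> 0"
    have "eventually (\<lambda>k. dist (H k) 0 < \<delta> / 2) sequentially"
      using H(2) \<delta> by (intro tendstoD) auto
    then obtain k0 where k0: "\<And>k. k0 \<le> k \<Longrightarrow> \<bar>H k\<bar> < \<delta> / 2"
      by (auto simp: eventually_sequentially)
    have lim_k0: "(\<lambda>k. \<integral>\<omega>. (exp (V \<omega> + H (k + k0) * U \<omega>) - exp (V \<omega>)) / H (k + k0) \<partial>M) \<longlonglongrightarrow> (\<integral>\<omega>. U \<omega> * exp (V \<omega>) \<partial>M)"
      using H k0 by (intro dom) (auto intro!: LIMSEQ_ignore_initial_segment less_imp_le)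
    have eq_k0: "(\<integral>\<omega>. (exp (V \<omega> + H (k + k0) * U \<omega>) - exp (V \<omega>)) / H (k + k0) \<partial>M) =
      ((\<integral>\<omega>. exp (V \<omega> + H (k + k0) * U \<omega>) \<partial>M) - (\<integral>\<omega>. exp (V \<omega> + 0 * U \<omega>) \<partial>M)) / (H (k + k0) - 0)" for k
      using int[of "H (k + k0)"] int[of 0] k0[of "k + k0"] \<delta> by simp
    have "(\<lambda>k. ((\<integral>\<omega>. exp (V \<omega> + H (k + k0) * U \<omega>) \<partial>M) - (\<integral>\<omega>. exp (V \<omega> + 0 * U \<omega>) \<partial>M)) / (H (k + k0) - 0))
        \<longlonglongrightarrow> (\<integral>\<omega>. U \<omega> * exp (V \<omega>) \<partial>M)"
      using lim_k0 unfolding eq_k0 .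
    then show "(\<lambda>k. ((\<integral>\<omega>. exp (V \<omega> + H k * U \<omega>) \<partial>M) - (\<integral>\<omega>. exp (V \<omega> + 0 * U \<omega>) \<partial>M)) / (H k - 0))
        \<longlonglongrightarrow> (\<integral>\<omega>. U \<omega> * exp (V \<omega>) \<partial>M)"
      by (rule LIMSEQ_offset)
  qed
qed

section \<open>Continuity in time\<close>

definition ones :: "real^'c::finite" where
  "ones = (\<chi> j. 1)"

lemma total_eq_inner: "total x = ones \<bullet> x"
  by (simp add: total_def ones_def inner_vec_def)

lemma inner_le_on_simplex:
  fixes x u :: "real^'c::finite"
  assumes "\<And>j. 0 \<le> x $ j" "total x \<le> R"
  shows "x $ i \<le> R" "u \<bullet> x \<le> (\<Sum>j\<in>UNIV. \<bar>u $ j\<bar>) * R"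
proof -
  have comp: "x $ j \<le> R" for j
    using assms member_le_sum[of j UNIV "\<lambda>j. x $ j"] by (auto simp: total_def)
  show "x $ i \<le> R" by (rule comp)
  have "u $ j * x $ j \<le> \<bar>u $ j\<bar> * R" for j
  proof -
    have "u $ j * x $ j \<le> \<bar>u $ j\<bar> * x $ j"
      using assms(1) by (intro mult_right_mono) auto
    also have "\<dots> \<le> \<bar>u $ j\<bar> * R"
      using comp by (intro mult_left_mono) auto
    finally show ?thesis .
  qed
  then show "u \<bullet> x \<le> (\<Sum>j\<in>UNIV. \<bar>u $ j\<bar>) * R"
    by (simp add: inner_vec_def sum_distrib_right sum_mono)
qed

lemma joint_mgf_eq_inner: "joint_mgf M Z u = (\<integral>\<omega>. exp (u \<bullet> Z \<omega>) \<partial>M)"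
  by (simp add: joint_mgf_def inner_vec_def)

lemma joint_mgf_finite_eq_inner: "joint_mgf_finite M Z u \<longleftrightarrow> integrable M (\<lambda>\<omega>. exp (u \<bullet> Z \<omega>))"
  by (simp add: joint_mgf_finite_def inner_vec_def)

text \<open>Polynomial factors cost a shift of the argument by \<open>\<eta>\<close> in every coordinate. The first bound
  gives integrability, the second one tightness.\<close>
lemma weighted_exp_bounds:
  fixes x :: "real^'c::finite"
  assumes x: "\<And>j. 0 \<le> x $ j" and \<eta>: "0 < \<eta>"
  shows "x $ i * exp (u \<bullet> x) \<le> 1 / \<eta> * exp ((u + \<eta> *\<^sub>R ones) \<bullet> x)"
    and "x $ i * exp (u \<bullet> x) * total x \<le> 2 / \<eta>\<^sup>2 * exp ((u + \<eta> *\<^sub>R ones) \<bullet> x)"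
proof -
  have tot: "x $ i \<le> total x" "0 \<le> total x"
    using inner_le_on_simplex(1)[of x "total x" i] x by (auto simp: total_def sum_nonneg)
  have e: "exp ((u + \<eta> *\<^sub>R ones) \<bullet> x) = exp (u \<bullet> x) * exp (\<eta> * total x)"
    by (simp add: inner_add_left total_eq_inner exp_add)
  have "\<eta> * total x \<le> exp (\<eta> * total x)"
    using exp_ge_add_one_self[of "\<eta> * total x"] by linarith
  then have "total x \<le> 1 / \<eta> * exp (\<eta> * total x)"
    using \<eta> by (simp add: field_simps)
  with tot have "x $ i \<le> 1 / \<eta> * exp (\<eta> * total x)" by linarith
  from mult_right_mono[OF this, of "exp (u \<bullet> x)"]
  show "x $ i * exp (u \<bullet> x) \<le> 1 / \<eta> * exp ((u + \<eta> *\<^sub>R ones) \<bullet> x)"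
    by (simp add: e mult_ac)
  have "1 + \<eta> * total x + (\<eta> * total x)\<^sup>2 / 2 \<le> exp (\<eta> * total x)"
    using tot \<eta> by (intro exp_lower_Taylor_quadratic) auto
  then have "(\<eta> * total x)\<^sup>2 / 2 \<le> exp (\<eta> * total x)"
    using mult_nonneg_nonneg[of \<eta> "total x"] tot \<eta> by linarith
  then have "total x * total x \<le> 2 / \<eta>\<^sup>2 * exp (\<eta> * total x)"
    using \<eta> by (simp add: field_simps power2_eq_square)
  moreover have "x $ i * total x \<le> total x * total x"
    using tot by (intro mult_right_mono)
  ultimately have "x $ i * total x \<le> 2 / \<eta>\<^sup>2 * exp (\<eta> * total x)" by linarith
  from mult_right_mono[OF this, of "exp (u \<bullet> x)"]
  show "x $ i * exp (u \<bullet> x) * total x \<le> 2 / \<eta>\<^sup>2 * exp ((u + \<eta> *\<^sub>R ones) \<bullet> x)"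
    by (simp add: e mult_ac)
qed

context tenable_polya_walk
begin

lemma X_nonneg: "0 \<le> r \<Longrightarrow> AE \<omega> in M. \<forall>j. 0 \<le> X r \<omega> $ j"
  using tenable unfolding tenable_def by (auto elim: eventually_mono)

text \<open>The waiting time has a density given the history.\<close>
lemma renewal_time_no_atom: "AE \<omega> in M. T (Suc n) \<omega> \<noteq> r"
proof -
  note [measurable] = T_measurable
  let ?g = "\<lambda>\<omega> w. if T n \<omega> + w = r then 1 else 0 :: ennreal"
  have "(\<integral>\<^sup>+ \<omega>. ?g \<omega> (W n \<omega>) \<partial>M) =
    (\<integral>\<^sup>+ \<omega>. (\<integral>\<^sup>+ w. ?g \<omega> w * ennreal (exponential_density (total (Y n \<omega>)) w) \<partial>lborel) \<partial>M)"
    by (rule renewal_integral_all_colors) measurable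
  also have "\<dots> = (\<integral>\<^sup>+ \<omega>. 0 \<partial>M)"
  proof (rule nn_integral_cong)
    fix \<omega>
    have "(\<integral>\<^sup>+ w. ?g \<omega> w * ennreal (exponential_density (total (Y n \<omega>)) w) \<partial>lborel) = (\<integral>\<^sup>+ (w::real). 0 \<partial>lborel)"
      using AE_lborel_singleton[of "r - T n \<omega>"]
      by (intro nn_integral_cong_AE) (auto elim!: eventually_mono)
    then show "(\<integral>\<^sup>+ w. ?g \<omega> w * ennreal (exponential_density (total (Y n \<omega>)) w) \<partial>lborel) = 0" by simp
  qed
  finally have "(\<integral>\<^sup>+ \<omega>. (if T (Suc n) \<omega> = r then 1 else 0) \<partial>M) = (0::ennreal)" by simp
  then show ?thesis
    by (subst (asm) nn_integral_0_iff_AE) (auto elim!: eventually_mono split: if_splits)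
qed

text \<open>A fixed time is almost surely not a renewal time, except for \<open>T 0 = 0\<close>, where there are no earlier
  times to consider.\<close>
lemma locally_constant_path:
  assumes R: "R \<longlonglongrightarrow> r" "0 \<le> r" "\<And>k. 0 \<le> R k"
  shows "AE \<omega> in M. eventually (\<lambda>k. X (R k) \<omega> = X r \<omega>) sequentially"
proof -
  have "AE \<omega> in M. \<forall>n. T (Suc n) \<omega> \<noteq> r"
    using renewal_time_no_atom by (simp add: AE_all_countable)
  with regular_paths show ?thesis
  proof eventually_elim
    case (elim \<omega>)
    with R obtain m where "\<And>n. T n \<omega> \<le> r \<and> r < T (Suc n) \<omega> \<longleftrightarrow> n = m"
      using unique_epoch by metis
    then have m: "T m \<omega> \<le> r" "r < T (Suc m) \<omega>" by blast+
    have "eventually (\<lambda>k. T m \<omega> \<le> R k) sequentially"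
    proof (cases m)
      case 0
      with elim R show ?thesis by simp
    next
      case (Suc l)
      with elim m have "T m \<omega> < r" by (metis order_less_le)
      from order_tendstoD(1)[OF R(1) this] show ?thesis by (auto elim: eventually_mono)
    qed
    then have "eventually (\<lambda>k. T m \<omega> \<le> R k \<and> R k < T (Suc m) \<omega>) sequentially"
      using order_tendstoD(2)[OF R(1) m(2)] by (rule eventually_conj)
    then show ?case
    proof (rule eventually_mono)
      fix k assume "T m \<omega> \<le> R k \<and> R k < T (Suc m) \<omega>"
      with elim m show "X (R k) \<omega> = X r \<omega>" by metis
    qed
  qed
qed

text \<open>Resting during \<open>]r, s]\<close> has probability \<open>exp (- (s - r) * total (X r))\<close>, which is compensated by
  adding \<open>s - r\<close> to every coordinate of the argument.\<close>
lemma mgf_earlier_le: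
  assumes "0 \<le> r" "r \<le> s"
  shows "(\<integral>\<^sup>+ \<omega>. ennreal (exp (v \<bullet> X r \<omega>)) \<partial>M) \<le>
    (\<integral>\<^sup>+ \<omega>. ennreal (exp ((v + (s - r) *\<^sub>R ones) \<bullet> X s \<omega>)) \<partial>M)"
  using no_renewal_bound[of r "s - r" "\<lambda>x. ennreal (exp ((v + (s - r) *\<^sub>R ones) \<bullet> x))"] assms
  by (simp add: total_eq_inner inner_add_left algebra_simps flip: ennreal_mult exp_add)

lemma weighted_mgf_integrable:
  assumes "0 \<le> r" "0 < \<eta>" and int: "integrable M (\<lambda>\<omega>. exp ((u + \<eta> *\<^sub>R ones) \<bullet> X r \<omega>))"
  shows "integrable M (\<lambda>\<omega>. X r \<omega> $ i * exp (u \<bullet> X r \<omega>))"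
proof (rule Bochner_Integration.integrable_bound)
  note [measurable] = X_measurable[OF assms(1)]
  show "integrable M (\<lambda>\<omega>. 1 / \<eta> * exp ((u + \<eta> *\<^sub>R ones) \<bullet> X r \<omega>))" using int by simp
  show "(\<lambda>\<omega>. X r \<omega> $ i * exp (u \<bullet> X r \<omega>)) \<in> borel_measurable M" by measurable
  show "AE \<omega> in M. norm (X r \<omega> $ i * exp (u \<bullet> X r \<omega>)) \<le> norm (1 / \<eta> * exp ((u + \<eta> *\<^sub>R ones) \<bullet> X r \<omega>))"
    using X_nonneg[OF assms(1)]
  proof eventually_elim
    case (elim \<omega>)
    with weighted_exp_bounds(1)[of "X r \<omega>" \<eta> i u] assms(2) show ?case by (simp add: abs_mult)
  qed
qed

lemma continuous_bounded_functional:
  fixes q :: "real^'c \<Rightarrow> real"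
  assumes [measurable]: "q \<in> borel_measurable borel" and bound: "\<And>x. (\<And>j. 0 \<le> x $ j) \<Longrightarrow> \<bar>q x\<bar> \<le> C"
    and "0 \<le> a"
  shows "continuous_on {a..b} (\<lambda>r. \<integral>\<omega>. q (X r \<omega>) \<partial>M)"
proof (rule continuous_on_sequentiallyI)
  fix R r assume R: "\<forall>k. R k \<in> {a..b}" "r \<in> {a..b}" "R \<longlonglongrightarrow> r"
  have pos: "0 \<le> R k" "0 \<le> r" for k using R \<open>0 \<le> a\<close> by (auto intro: order_trans)
  note [measurable] = X_measurable[OF pos(1)] X_measurable[OF pos(2)]
  show "(\<lambda>k. \<integral>\<omega>. q (X (R k) \<omega>) \<partial>M) \<longlonglongrightarrow> (\<integral>\<omega>. q (X r \<omega>) \<partial>M)"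
  proof (rule integral_dominated_convergence[where w="\<lambda>_. C"])
    show "AE \<omega> in M. (\<lambda>k. q (X (R k) \<omega>)) \<longlonglongrightarrow> q (X r \<omega>)"
      using locally_constant_path[OF R(3) pos(2) pos(1)]
    proof eventually_elim
      case (elim \<omega>)
      then have "eventually (\<lambda>k. q (X (R k) \<omega>) = q (X r \<omega>)) sequentially"
        by (auto elim: eventually_mono)
      then show ?case by (rule tendsto_eventually)
    qed
    show "AE \<omega> in M. norm (q (X (R k) \<omega>)) \<le> C" for k
      using X_nonneg[OF pos(1)[of k]] bound by (auto elim: eventually_mono)
  qed (simp_all, measurable)
qed

text \<open>The integrand is unbounded, so it is cut off by the factor \<open>max 0 (1 - total x / (N + 1))\<close>. The
  truncated expectations are continuous by \<open>continuous_bounded_functional\<close>, and by the second bound of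
  \<open>weighted_exp_bounds\<close> they converge at a rate that is uniform in time.\<close>
lemma continuous_weighted_mgf:
  assumes "0 \<le> a" "0 < \<eta>"
    and int: "\<And>r. r \<in> {a..b} \<Longrightarrow> integrable M (\<lambda>\<omega>. exp ((u + \<eta> *\<^sub>R ones) \<bullet> X r \<omega>))"
    and bound: "\<And>r. r \<in> {a..b} \<Longrightarrow> (\<integral>\<omega>. exp ((u + \<eta> *\<^sub>R ones) \<bullet> X r \<omega>) \<partial>M) \<le> C"
  shows "continuous_on {a..b} (\<lambda>r. \<integral>\<omega>. X r \<omega> $ i * exp (u \<bullet> X r \<omega>) \<partial>M)"
proof -
  define q where "q x = x $ i * exp (u \<bullet> x)" for x :: "real^'c"
  define qN where "qN N x = q x * max 0 (1 - total x / real (Suc N))" for N and x :: "real^'c"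
  have [measurable]: "q \<in> borel_measurable borel" "qN N \<in> borel_measurable borel" for N
    unfolding q_def qN_def by measurable
  have q_nonneg: "0 \<le> q x" if "\<And>j. 0 \<le> x $ j" for x using that by (simp add: q_def)
  have cont: "continuous_on {a..b} (\<lambda>r. \<integral>\<omega>. qN N (X r \<omega>) \<partial>M)" for N
  proof (rule continuous_bounded_functional[OF _ _ \<open>0 \<le> a\<close>])
    fix x :: "real^'c" assume x: "\<And>j. 0 \<le> x $ j"
    have tot: "0 \<le> total x" using x by (simp add: total_def sum_nonneg)
    \<comment> \<open>The cutoff vanishes outside of the simplex \<open>total x \<le> N + 1\<close>, on which \<open>q\<close> is bounded.\<close>
    show "\<bar>qN N x\<bar> \<le> real (Suc N) * exp ((\<Sum>j\<in>UNIV. \<bar>u $ j\<bar>) * real (Suc N))"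
    proof (cases "total x \<le> real (Suc N)")
      case True
      have "q x \<le> real (Suc N) * exp ((\<Sum>j\<in>UNIV. \<bar>u $ j\<bar>) * real (Suc N))"
        unfolding q_def using inner_le_on_simplex[OF x True] x by (intro mult_mono) auto
      moreover have "\<bar>qN N x\<bar> \<le> q x"
        unfolding qN_def using True tot q_nonneg[OF x] by (simp add: abs_mult mult_left_le)
      ultimately show ?thesis by linarith
    next
      case False
      then have "qN N x = 0" by (simp add: qN_def field_simps)
      then show ?thesis by simp
    qed
  qed measurable
  define D where "D = 2 / \<eta>\<^sup>2 * C"
  have near: "\<bar>(\<integral>\<omega>. qN N (X r \<omega>) \<partial>M) - (\<integral>\<omega>. q (X r \<omega>) \<partial>M)\<bar> \<le> D / real (Suc N)" if r: "r \<in> {a..b}" for N r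
  proof -
    have r0: "0 \<le> r" using r assms by auto
    note [measurable] = X_measurable[OF r0]
    have qi: "integrable M (\<lambda>\<omega>. q (X r \<omega>))"
      unfolding q_def by (rule weighted_mgf_integrable[OF r0 assms(2) int[OF r]])
    have diff: "AE \<omega> in M. \<bar>qN N (X r \<omega>) - q (X r \<omega>)\<bar> \<le> 2 / \<eta>\<^sup>2 * exp ((u + \<eta> *\<^sub>R ones) \<bullet> X r \<omega>) / real (Suc N)
        \<and> \<bar>qN N (X r \<omega>)\<bar> \<le> \<bar>q (X r \<omega>)\<bar>"
      using X_nonneg[OF r0]
    proof eventually_elim
      case (elim \<omega>)
      let ?x = "X r \<omega>"
      have tot: "0 \<le> total ?x / real (Suc N)" using elim by (simp add: total_def sum_nonneg)
      then have m: "0 \<le> 1 - max 0 (1 - total ?x / real (Suc N))" "1 - max 0 (1 - total ?x / real (Suc N)) \<le> total ?x / real (Suc N)"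
        by auto
      have "qN N ?x - q ?x = - (q ?x * (1 - max 0 (1 - total ?x / real (Suc N))))"
        by (simp add: qN_def algebra_simps)
      then have "\<bar>qN N ?x - q ?x\<bar> = q ?x * (1 - max 0 (1 - total ?x / real (Suc N)))"
        using m(1) q_nonneg elim by (simp add: abs_mult)
      also have "\<dots> \<le> q ?x * (total ?x / real (Suc N))"
        using m(2) q_nonneg elim by (intro mult_left_mono) auto
      also have "\<dots> \<le> 2 / \<eta>\<^sup>2 * exp ((u + \<eta> *\<^sub>R ones) \<bullet> ?x) / real (Suc N)"
        using divide_right_mono[OF weighted_exp_bounds(2)[of ?x \<eta> i u], of "real (Suc N)"] elim assms(2)
        by (simp add: q_def del: of_nat_Suc)
      finally have "\<bar>qN N ?x - q ?x\<bar> \<le> 2 / \<eta>\<^sup>2 * exp ((u + \<eta> *\<^sub>R ones) \<bullet> ?x) / real (Suc N)" .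
      moreover have "\<bar>qN N ?x\<bar> \<le> \<bar>q ?x\<bar>"
        using tot unfolding qN_def abs_mult by (intro mult_left_le) auto
      ultimately show ?case by simp
    qed
    have qNi: "integrable M (\<lambda>\<omega>. qN N (X r \<omega>))"
      by (rule Bochner_Integration.integrable_bound[OF qi]) (use diff in \<open>auto elim: eventually_mono\<close>)
    have "\<bar>(\<integral>\<omega>. qN N (X r \<omega>) \<partial>M) - (\<integral>\<omega>. q (X r \<omega>) \<partial>M)\<bar> = \<bar>\<integral>\<omega>. qN N (X r \<omega>) - q (X r \<omega>) \<partial>M\<bar>"
      using qi qNi by simp
    also have "\<dots> \<le> (\<integral>\<omega>. \<bar>qN N (X r \<omega>) - q (X r \<omega>)\<bar> \<partial>M)"
      by (rule integral_abs_bound)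
    also have "\<dots> \<le> (\<integral>\<omega>. 2 / \<eta>\<^sup>2 * exp ((u + \<eta> *\<^sub>R ones) \<bullet> X r \<omega>) / real (Suc N) \<partial>M)"
      using diff qi qNi int[OF r]
      by (intro integral_mono_AE) (auto elim: eventually_mono simp del: of_nat_Suc)
    also have "\<dots> = 2 / \<eta>\<^sup>2 * (\<integral>\<omega>. exp ((u + \<eta> *\<^sub>R ones) \<bullet> X r \<omega>) \<partial>M) / real (Suc N)"
      by simp
    also have "\<dots> \<le> D / real (Suc N)"
      unfolding D_def using bound[OF r] by (intro divide_right_mono mult_left_mono) auto
    finally show ?thesis .
  qed
  have "uniform_limit {a..b} (\<lambda>N r. \<integral>\<omega>. qN N (X r \<omega>) \<partial>M) (\<lambda>r. \<integral>\<omega>. q (X r \<omega>) \<partial>M) sequentially"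
  proof (rule uniform_limitI)
    fix e :: real assume "0 < e"
    have "(\<lambda>N. D / real (Suc N)) \<longlonglongrightarrow> 0" by real_asymp
    from order_tendstoD(2)[OF this \<open>0 < e\<close>]
    show "\<forall>\<^sub>F N in sequentially. \<forall>r\<in>{a..b}. dist (\<integral>\<omega>. qN N (X r \<omega>) \<partial>M) (\<integral>\<omega>. q (X r \<omega>) \<partial>M) < e"
    proof eventually_elim
      case (elim N)
      then show ?case
        unfolding dist_real_def using near[of _ N] by (blast intro: le_less_trans)
    qed
  qed
  then have "continuous_on {a..b} (\<lambda>r. \<integral>\<omega>. q (X r \<omega>) \<partial>M)"
    by (rule uniform_limit_theorem[OF always_eventually[OF allI[OF cont]]]) simp
  then show ?thesis by (simp add: q_def)
qed

section \<open>The differential equation\<close>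

lemma renewal_intensity_colors:
  fixes q :: "real^'c \<Rightarrow> ennreal" and h :: "'c \<Rightarrow> real^'c^'c \<Rightarrow> ennreal"
  assumes a: "0 \<le> a" and [measurable]: "q \<in> borel_measurable borel" "\<And>i. h i \<in> borel_measurable borel"
  shows "(\<integral>\<^sup>+ \<omega>. (\<Sum>n. if a < T (Suc n) \<omega> \<and> T (Suc n) \<omega> \<le> b then q (Y n \<omega>) * h (K n \<omega>) (B n \<omega>) else 0) \<partial>M) =
    (\<Sum>i\<in>UNIV. (\<integral>\<^sup>+ r. (\<integral>\<^sup>+ \<omega>. ennreal (X r \<omega> $ i) * q (X r \<omega>) \<partial>M) * indicator {a..b} r \<partial>lborel) * (\<integral>\<^sup>+ \<omega>. h i (A \<omega>) \<partial>M))"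
proof -
  let ?J = "\<lambda>n i \<omega>. (if a < T (Suc n) \<omega> \<and> T (Suc n) \<omega> \<le> b then q (Y n \<omega>) else 0) *
        indicator {\<omega>. K n \<omega> = i} \<omega> * h i (B n \<omega>)"
  have "(if a < T (Suc n) \<omega> \<and> T (Suc n) \<omega> \<le> b then q (Y n \<omega>) * h (K n \<omega>) (B n \<omega>) else 0) =
      (\<Sum>i\<in>UNIV. ?J n i \<omega>)" for n \<omega>
    by (subst sum.remove[of _ "K n \<omega>"]) (auto simp: indicator_def)
  then have "(\<integral>\<^sup>+ \<omega>. (\<Sum>n. if a < T (Suc n) \<omega> \<and> T (Suc n) \<omega> \<le> b then q (Y n \<omega>) * h (K n \<omega>) (B n \<omega>) else 0) \<partial>M) =
      (\<integral>\<^sup>+ \<omega>. (\<Sum>n. \<Sum>i\<in>UNIV. ?J n i \<omega>) \<partial>M)"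
    by simp
  also have "\<dots> = (\<integral>\<^sup>+ \<omega>. (\<Sum>i\<in>UNIV. \<Sum>n. ?J n i \<omega>) \<partial>M)"
    by (intro nn_integral_cong suminf_sum) simp
  also have "\<dots> = (\<Sum>i\<in>UNIV. \<integral>\<^sup>+ \<omega>. (\<Sum>n. ?J n i \<omega>) \<partial>M)"
    by (rule nn_integral_sum) measurable
  finally show ?thesis
    by (simp only: renewal_intensity[OF a assms(2,3)])
qed

text \<open>The expectation of \<open>telescope\<close> for \<open>f x = exp (u \<bullet> x)\<close>. A renewal of color \<open>i\<close> multiplies \<open>f\<close> by
  \<open>exp (u \<bullet> A $ i)\<close>, which is independent of the past, whence the factors on the right-hand side.\<close>
lemma mgf_balance:
  assumes "0 \<le> a" "a \<le> b"
  shows "(\<integral>\<^sup>+ \<omega>. ennreal (exp (u \<bullet> X b \<omega>)) \<partial>M) +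
      (\<Sum>i\<in>UNIV. (\<integral>\<^sup>+ r. (\<integral>\<^sup>+ \<omega>. ennreal (X r \<omega> $ i) * ennreal (exp (u \<bullet> X r \<omega>)) \<partial>M) * indicator {a..b} r \<partial>lborel)) =
    (\<integral>\<^sup>+ \<omega>. ennreal (exp (u \<bullet> X a \<omega>)) \<partial>M) +
      (\<Sum>i\<in>UNIV. (\<integral>\<^sup>+ r. (\<integral>\<^sup>+ \<omega>. ennreal (X r \<omega> $ i) * ennreal (exp (u \<bullet> X r \<omega>)) \<partial>M) * indicator {a..b} r \<partial>lborel) *
        (\<integral>\<^sup>+ \<omega>. ennreal (exp (u \<bullet> A \<omega> $ i)) \<partial>M))"
proof -
  let ?f = "\<lambda>x::real^'c. ennreal (exp (u \<bullet> x))"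
  note [measurable] = X_measurable[of a] X_measurable[of b]
  have [measurable]: "X a \<in> borel_measurable M" "X b \<in> borel_measurable M"
    using assms by (auto intro: X_measurable)
  have jump: "?f (Y (Suc n) \<omega>) = ?f (Y n \<omega>) * ennreal (exp (u \<bullet> B n \<omega> $ K n \<omega>))" for n \<omega>
    by (simp add: inner_add_right exp_add ennreal_mult)
  have "(\<integral>\<^sup>+ \<omega>. ?f (X b \<omega>) \<partial>M) +
      (\<integral>\<^sup>+ \<omega>. (\<Sum>n. if a < T (Suc n) \<omega> \<and> T (Suc n) \<omega> \<le> b then ?f (Y n \<omega>) else 0) \<partial>M) =
    (\<integral>\<^sup>+ \<omega>. ?f (X b \<omega>) + (\<Sum>n. if a < T (Suc n) \<omega> \<and> T (Suc n) \<omega> \<le> b then ?f (Y n \<omega>) else 0) \<partial>M)"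
    by (rule nn_integral_add[symmetric]) measurable
  also have "\<dots> = (\<integral>\<^sup>+ \<omega>. ?f (X a \<omega>) +
      (\<Sum>n. if a < T (Suc n) \<omega> \<and> T (Suc n) \<omega> \<le> b then ?f (Y (Suc n) \<omega>) else 0) \<partial>M)"
    by (intro nn_integral_cong_AE telescope assms)
  also have "\<dots> = (\<integral>\<^sup>+ \<omega>. ?f (X a \<omega>) \<partial>M) +
      (\<integral>\<^sup>+ \<omega>. (\<Sum>n. if a < T (Suc n) \<omega> \<and> T (Suc n) \<omega> \<le> b then ?f (Y (Suc n) \<omega>) else 0) \<partial>M)"
    by (rule nn_integral_add) measurable
  finally have eq: "(\<integral>\<^sup>+ \<omega>. ?f (X b \<omega>) \<partial>M) +
      (\<integral>\<^sup>+ \<omega>. (\<Sum>n. if a < T (Suc n) \<omega> \<and> T (Suc n) \<omega> \<le> b then ?f (Y n \<omega>) * 1 else 0) \<partial>M) =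
    (\<integral>\<^sup>+ \<omega>. ?f (X a \<omega>) \<partial>M) +
      (\<integral>\<^sup>+ \<omega>. (\<Sum>n. if a < T (Suc n) \<omega> \<and> T (Suc n) \<omega> \<le> b
        then ?f (Y n \<omega>) * ennreal (exp (u \<bullet> B n \<omega> $ K n \<omega>)) else 0) \<partial>M)"
    unfolding jump by (simp only: mult_1_right)
  have before: "(\<integral>\<^sup>+ \<omega>. (\<Sum>n. if a < T (Suc n) \<omega> \<and> T (Suc n) \<omega> \<le> b then ?f (Y n \<omega>) * 1 else 0) \<partial>M) =
    (\<Sum>i\<in>UNIV. (\<integral>\<^sup>+ r. (\<integral>\<^sup>+ \<omega>. ennreal (X r \<omega> $ i) * ?f (X r \<omega>) \<partial>M) * indicator {a..b} r \<partial>lborel) *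
      (\<integral>\<^sup>+ \<omega>. 1 \<partial>M))"
    by (rule renewal_intensity_colors[OF assms(1)]) measurable
  have after: "(\<integral>\<^sup>+ \<omega>. (\<Sum>n. if a < T (Suc n) \<omega> \<and> T (Suc n) \<omega> \<le> b
        then ?f (Y n \<omega>) * ennreal (exp (u \<bullet> B n \<omega> $ K n \<omega>)) else 0) \<partial>M) =
    (\<Sum>i\<in>UNIV. (\<integral>\<^sup>+ r. (\<integral>\<^sup>+ \<omega>. ennreal (X r \<omega> $ i) * ?f (X r \<omega>) \<partial>M) * indicator {a..b} r \<partial>lborel) *
      (\<integral>\<^sup>+ \<omega>. ennreal (exp (u \<bullet> A \<omega> $ i)) \<partial>M))"
    by (rule renewal_intensity_colors[OF assms(1), of ?f "\<lambda>i m. ennreal (exp (u \<bullet> m $ i))"]) measurable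
  show ?thesis
    using eq unfolding before after by (simp add: emeasure_space_1)
qed

text \<open>Where all its terms are finite, \<open>mgf_balance\<close> is an equation of real numbers, and the increment of
  the moment generating function can be isolated.\<close>
lemma mgf_increment:
  assumes "0 \<le> a" "a \<le> b" "0 < \<eta>"
    and int: "\<And>r. r \<in> {a..b} \<Longrightarrow> integrable M (\<lambda>\<omega>. exp ((u + \<eta> *\<^sub>R ones) \<bullet> X r \<omega>))"
    and int_u: "\<And>r. r \<in> {a..b} \<Longrightarrow> integrable M (\<lambda>\<omega>. exp (u \<bullet> X r \<omega>))"
    and int_A: "\<And>i. integrable M (\<lambda>\<omega>. exp (u \<bullet> A \<omega> $ i))"
    and cont: "\<And>i. continuous_on {a..b} (\<lambda>r. \<integral>\<omega>. X r \<omega> $ i * exp (u \<bullet> X r \<omega>) \<partial>M)"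
  shows "joint_mgf M (X b) u = joint_mgf M (X a) u +
    (\<Sum>i\<in>UNIV. (joint_mgf M (\<lambda>\<omega>. A \<omega> $ i) u - 1) *
      integral {a..b} (\<lambda>r. \<integral>\<omega>. X r \<omega> $ i * exp (u \<bullet> X r \<omega>) \<partial>M))"
proof -
  define g where "g i r = (\<integral>\<omega>. X r \<omega> $ i * exp (u \<bullet> X r \<omega>) \<partial>M)" for i r
  define I where "I i = integral {a..b} (g i)" for i
  have r0: "0 \<le> r" if "r \<in> {a..b}" for r using that assms by auto
  have g_nonneg: "0 \<le> g i r" if "r \<in> {a..b}" for i r
    unfolding g_def using X_nonneg[OF r0[OF that]] by (intro integral_nonneg_AE) (auto elim: eventually_mono)
  have inner: "(\<integral>\<^sup>+ \<omega>. ennreal (X r \<omega> $ i) * ennreal (exp (u \<bullet> X r \<omega>)) \<partial>M) = ennreal (g i r)"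
    if r: "r \<in> {a..b}" for i r
  proof -
    have "(\<integral>\<^sup>+ \<omega>. ennreal (X r \<omega> $ i) * ennreal (exp (u \<bullet> X r \<omega>)) \<partial>M) =
      (\<integral>\<^sup>+ \<omega>. ennreal (X r \<omega> $ i * exp (u \<bullet> X r \<omega>)) \<partial>M)"
      by (simp flip: ennreal_mult'')
    also have "\<dots> = ennreal (g i r)"
      unfolding g_def
      using X_nonneg[OF r0[OF r]] weighted_mgf_integrable[OF r0[OF r] assms(3) int[OF r]]
      by (intro nn_integral_eq_integral) (auto elim: eventually_mono)
    finally show ?thesis .
  qed
  have I_nonneg: "0 \<le> I i" for i
    unfolding I_def using cont g_nonneg
    by (intro integral_nonneg integrable_continuous_real) (auto simp: g_def)
  have outer: "(\<integral>\<^sup>+ r. (\<integral>\<^sup>+ \<omega>. ennreal (X r \<omega> $ i) * ennreal (exp (u \<bullet> X r \<omega>)) \<partial>M) * indicator {a..b} r \<partial>lborel) = ennreal (I i)" for i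
  proof -
    have "set_integrable lborel {a..b} (g i)"
      using cont[of i] by (intro borel_integrable_atLeastAtMost') (simp add: g_def)
    then have si: "integrable lborel (\<lambda>r. indicator {a..b} r *\<^sub>R g i r)" "(LINT r:{a..b}|lborel. g i r) = I i"
      by (simp_all add: set_integrable_def I_def set_borel_integral_eq_integral)
    have "(\<integral>\<^sup>+ r. (\<integral>\<^sup>+ \<omega>. ennreal (X r \<omega> $ i) * ennreal (exp (u \<bullet> X r \<omega>)) \<partial>M) * indicator {a..b} r \<partial>lborel) =
      (\<integral>\<^sup>+ r. ennreal (indicator {a..b} r *\<^sub>R g i r) \<partial>lborel)"
      by (intro nn_integral_cong) (auto simp: inner indicator_def)
    also have "\<dots> = ennreal (LINT r:{a..b}|lborel. g i r)"
      unfolding set_lebesgue_integral_def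
      by (intro nn_integral_eq_integral si) (auto simp: g_nonneg indicator_def)
    finally show ?thesis using si by simp
  qed
  have mgf: "(\<integral>\<^sup>+ \<omega>. ennreal (exp (u \<bullet> Z \<omega>)) \<partial>M) = ennreal (joint_mgf M Z u)"
    if "integrable M (\<lambda>\<omega>. exp (u \<bullet> Z \<omega>))" for Z :: "'w \<Rightarrow> real^'c"
    unfolding joint_mgf_eq_inner using that by (intro nn_integral_eq_integral) auto
  have mgf_nonneg: "0 \<le> joint_mgf M Z u" for Z :: "'w \<Rightarrow> real^'c"
    unfolding joint_mgf_eq_inner by (intro integral_nonneg_AE) auto
  let ?\<psi> = "\<lambda>i. joint_mgf M (\<lambda>\<omega>. A \<omega> $ i) u"
  have "ennreal (joint_mgf M (X b) u) + (\<Sum>i\<in>UNIV. ennreal (I i)) =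
      ennreal (joint_mgf M (X a) u) + (\<Sum>i\<in>UNIV. ennreal (I i) * ennreal (?\<psi> i))"
    using mgf_balance[OF assms(1,2), of u] assms(2)
    unfolding outer by (simp add: mgf int_u int_A)
  also have "(\<Sum>i\<in>UNIV. ennreal (I i) * ennreal (?\<psi> i)) = ennreal (\<Sum>i\<in>UNIV. I i * ?\<psi> i)"
    using I_nonneg mgf_nonneg by (simp add: sum_ennreal flip: ennreal_mult)
  finally have "ennreal (joint_mgf M (X b) u + (\<Sum>i\<in>UNIV. I i)) = ennreal (joint_mgf M (X a) u + (\<Sum>i\<in>UNIV. I i * ?\<psi> i))"
    using I_nonneg mgf_nonneg by (simp add: sum_ennreal sum_nonneg)
  then have "joint_mgf M (X b) u + (\<Sum>i\<in>UNIV. I i) = joint_mgf M (X a) u + (\<Sum>i\<in>UNIV. I i * ?\<psi> i)"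
    using I_nonneg mgf_nonneg by (subst (asm) ennreal_inj) (auto intro!: add_nonneg_nonneg sum_nonneg)
  then show ?thesis
    unfolding g_def[symmetric] I_def[symmetric] by (simp add: ring_distribs sum_subtractf mult.commute)
qed

text \<open>The interval is \<open>[max 0 (t - \<eta>), t + \<eta>]\<close>. Continuity of \<open>g i\<close> on it needs a bound on the moment
  generating function at \<open>u + \<eta> *\<^sub>R ones\<close>, and \<open>mgf_earlier_le\<close> compares all times \<open>r\<close> with the right
  end point at the cost of at most another \<open>2 * \<eta>\<close>; this is why moments are required up to the
  distance \<open>3 * \<eta>\<close> in the direction \<open>ones\<close>.\<close>
lemma mgf_time_derivative:
  assumes "0 \<le> t" "0 < \<eta>"
    and fin: "\<And>s v. 0 \<le> s \<Longrightarrow> \<bar>s - t\<bar> \<le> \<eta> \<Longrightarrow> norm (v - u) \<le> 3 * \<eta> * norm (ones :: real^'c) \<Longrightarrow>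
      integrable M (\<lambda>\<omega>. exp (v \<bullet> X s \<omega>))"
    and int_A: "\<And>i. integrable M (\<lambda>\<omega>. exp (u \<bullet> A \<omega> $ i))"
  shows "((\<lambda>s. joint_mgf M (X s) u) has_real_derivative
    (\<Sum>i\<in>UNIV. (joint_mgf M (\<lambda>\<omega>. A \<omega> $ i) u - 1) * (\<integral>\<omega>. X t \<omega> $ i * exp (u \<bullet> X t \<omega>) \<partial>M))) (at t within {0..})"
proof -
  define a b where "a = max 0 (t - \<eta>)" and "b = t + \<eta>"
  have ab: "0 \<le> a" "t \<in> {a..b}" "0 \<le> b" using assms by (auto simp: a_def b_def)
  have r: "0 \<le> r" "\<bar>r - t\<bar> \<le> \<eta>" if "r \<in> {a..b}" for r
    using that assms by (auto simp: a_def b_def)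
  let ?v = "u + \<eta> *\<^sub>R (ones :: real^'c)"
  have int: "integrable M (\<lambda>\<omega>. exp (?v \<bullet> X r \<omega>))" if "r \<in> {a..b}" for r
    using r[OF that] assms(2) by (intro fin) auto
  have int_u: "integrable M (\<lambda>\<omega>. exp (u \<bullet> X r \<omega>))" if "r \<in> {a..b}" for r
    using r[OF that] assms(2) by (intro fin) auto
  define C where "C = (\<integral>\<omega>. exp ((u + (3 * \<eta>) *\<^sub>R ones) \<bullet> X b \<omega>) \<partial>M)"
  have int_b: "integrable M (\<lambda>\<omega>. exp ((u + (3 * \<eta>) *\<^sub>R ones) \<bullet> X b \<omega>))"
    using ab assms(2) by (intro fin) (auto simp: b_def)
  have bound: "(\<integral>\<omega>. exp (?v \<bullet> X r \<omega>) \<partial>M) \<le> C" if rab: "r \<in> {a..b}" for r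
  proof -
    have "ennreal (\<integral>\<omega>. exp (?v \<bullet> X r \<omega>) \<partial>M) = (\<integral>\<^sup>+ \<omega>. ennreal (exp (?v \<bullet> X r \<omega>)) \<partial>M)"
      using int[OF rab] by (intro nn_integral_eq_integral[symmetric]) auto
    also have "\<dots> \<le> (\<integral>\<^sup>+ \<omega>. ennreal (exp ((?v + (b - r) *\<^sub>R ones) \<bullet> X b \<omega>)) \<partial>M)"
      using r[OF rab] rab by (intro mgf_earlier_le) auto
    also have "\<dots> \<le> (\<integral>\<^sup>+ \<omega>. ennreal (exp ((u + (3 * \<eta>) *\<^sub>R ones) \<bullet> X b \<omega>)) \<partial>M)"
    proof (rule nn_integral_mono_AE, use X_nonneg[OF ab(3)] in eventually_elim)
      case (elim \<omega>)
      have "(b - r) * total (X b \<omega>) \<le> 2 * \<eta> * total (X b \<omega>)"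
        using r[OF rab] elim by (intro mult_right_mono) (auto simp: b_def total_def sum_nonneg)
      then show ?case
        by (simp add: inner_add_left total_eq_inner ennreal_leI algebra_simps)
    qed
    also have "\<dots> = ennreal C"
      unfolding C_def using int_b by (intro nn_integral_eq_integral) auto
    finally show ?thesis
      by (simp add: C_def ennreal_le_iff)
  qed
  define g where "g i r = (\<integral>\<omega>. X r \<omega> $ i * exp (u \<bullet> X r \<omega>) \<partial>M)" for i r
  have cont: "continuous_on {a..b} (g i)" for i
    unfolding g_def by (rule continuous_weighted_mgf[OF ab(1) assms(2) int bound])
  let ?\<psi> = "\<lambda>i. joint_mgf M (\<lambda>\<omega>. A \<omega> $ i) u"
  have eq: "joint_mgf M (X s) u = joint_mgf M (X a) u + (\<Sum>i\<in>UNIV. (?\<psi> i - 1) * integral {a..s} (g i))"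
    if s: "s \<in> {a..b}" for s
    unfolding g_def
  proof (rule mgf_increment[OF ab(1) _ assms(2) _ _ int_A])
    show "continuous_on {a..s} (\<lambda>r. \<integral>\<omega>. X r \<omega> $ i * exp (u \<bullet> X r \<omega>) \<partial>M)" for i
      using s by (intro continuous_on_subset[OF cont[of i, unfolded g_def]]) auto
  qed (use s in \<open>auto intro: int int_u\<close>)
  have "((\<lambda>s. integral {a..s} (g i)) has_real_derivative g i t) (at t within {a..b})" for i
    by (rule integral_has_real_derivative[OF cont ab(2)])
  then have "((\<lambda>s. joint_mgf M (X a) u + (\<Sum>i\<in>UNIV. (?\<psi> i - 1) * integral {a..s} (g i))) has_real_derivative
      (\<Sum>i\<in>UNIV. (?\<psi> i - 1) * g i t)) (at t within {a..b})"
    by (auto intro!: derivative_eq_intros simp: mult.commute)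
  then have "((\<lambda>s. joint_mgf M (X s) u) has_real_derivative (\<Sum>i\<in>UNIV. (?\<psi> i - 1) * g i t)) (at t within {a..b})"
    by (rule has_field_derivative_transform_within[OF _ zero_less_one ab(2)]) (rule eq[symmetric])
  also have "at t within {a..b} = at t within {0..}"
    by (rule at_within_nhd[of _ "{t - \<eta> <..< t + \<eta>}"]) (use assms(2) in \<open>auto simp: a_def b_def\<close>)
  finally show ?thesis unfolding g_def .
qed

end

theorem theorem3p1:
  fixes M :: "'w measure" and F :: "nat \<Rightarrow> 'w measure"
    and A :: "'w \<Rightarrow> real^'c::finite^'c" and x0 :: "real^'c"
    and T :: "nat \<Rightarrow> 'w \<Rightarrow> real" and K :: "nat \<Rightarrow> 'w \<Rightarrow> 'c"
    and B :: "nat \<Rightarrow> 'w \<Rightarrow> real^'c^'c" and X :: "real \<Rightarrow> 'w \<Rightarrow> real^'c"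
    and t :: real and u :: "real^'c"
  assumes "polya_walk M F A x0 T K B X"
    and "tenable M X"
    and "(t, u) \<in> (top_of_set ({0..} \<times> UNIV)) interior_of (mgf_domain M X)"
    and "\<And>i. joint_mgf_finite M (\<lambda>\<omega>. A \<omega> $ i) u"
  shows "\<exists>\<phi>\<^sub>t \<phi>\<^sub>u.
      ((\<lambda>s. joint_mgf M (X s) u) has_real_derivative \<phi>\<^sub>t) (at t within {0..}) \<and>
      (\<forall>i. ((\<lambda>h. joint_mgf M (X t) (u + h *\<^sub>R axis i 1)) has_real_derivative \<phi>\<^sub>u i) (at 0)) \<and>
      \<phi>\<^sub>t + (\<Sum>i\<in>UNIV. (1 - joint_mgf M (\<lambda>\<omega>. A \<omega> $ i) u) * \<phi>\<^sub>u i) = 0"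
proof -
  interpret tenable_polya_walk M F A x0 T K B X
    using assms(1,2) by (intro tenable_polya_walk.intro tenable_polya_walk_axioms.intro)
  obtain V where V: "openin (top_of_set ({0..} \<times> UNIV)) V" "(t, u) \<in> V" "V \<subseteq> mgf_domain M X"
    using assms(3) unfolding interior_of_def by auto
  then obtain G where G: "open G" "V = ({0..} \<times> UNIV) \<inter> G"
    unfolding openin_open by auto
  then have tu: "0 \<le> t" "(t, u) \<in> G" using V by auto
  obtain e where e: "0 < e" "ball (t, u) e \<subseteq> G"
    using G(1) tu(2) by (meson open_contains_ball)
  \<comment> \<open>Arguments move by \<open>3 * \<eta>\<close> along \<open>ones\<close> for the derivative in time and by \<open>\<eta>\<close> along an axis for
      those in \<open>u\<close>; both are at most \<open>\<eta> * L\<close>, and times move by \<open>\<eta>\<close>.\<close>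
  define L where "L = 1 + 3 * norm (ones :: real^'c)"
  define \<eta> where "\<eta> = e / (2 * (1 + L))"
  have L: "1 \<le> L" by (simp add: L_def)
  then have \<eta>: "0 < \<eta>" "\<eta> * (1 + L) < e"
    using e(1) by (auto simp: \<eta>_def divide_less_eq)
  have fin: "integrable M (\<lambda>\<omega>. exp (v \<bullet> X s \<omega>))"
    if "0 \<le> s" "\<bar>s - t\<bar> \<le> \<eta>" "norm (v - u) \<le> \<eta> * L" for s v
  proof -
    have "dist (t, u) (s, v) \<le> \<bar>s - t\<bar> + norm (v - u)"
      unfolding dist_Pair_Pair
      using sqrt_sum_squares_le_sum[of "dist t s" "dist u v"] by (simp add: dist_norm norm_minus_commute)
    also have "\<dots> \<le> \<eta> * (1 + L)" using that by (simp add: distrib_left)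
    also have "\<dots> < e" by (rule \<eta>)
    finally have "(s, v) \<in> G" using e(2) by auto
    with that(1) G(2) V(3) have "(s, v) \<in> mgf_domain M X" by blast
    then show ?thesis by (simp add: mgf_domain_def joint_mgf_finite_eq_inner)
  qed
  note [measurable] = X_measurable[OF tu(1)]
  have deriv_u: "((\<lambda>h. joint_mgf M (X t) (u + h *\<^sub>R axis i 1)) has_real_derivative
      (\<integral>\<omega>. X t \<omega> $ i * exp (u \<bullet> X t \<omega>) \<partial>M)) (at 0)" for i
  proof -
    have shift: "(u + h *\<^sub>R axis i 1) \<bullet> x = u \<bullet> x + h * x $ i" for h and x :: "real^'c"
      by (simp add: inner_add_left inner_axis')
    have "integrable M (\<lambda>\<omega>. exp ((u + h *\<^sub>R axis i 1) \<bullet> X t \<omega>))" if "\<bar>h\<bar> = \<eta>" for h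
      using \<eta> L that tu by (intro fin) (auto simp: norm_axis_1)
    from this[of \<eta>] this[of "- \<eta>"] show ?thesis
      unfolding joint_mgf_eq_inner shift using \<eta>
      by (intro has_derivative_exponential_moment[of _ _ _ \<eta>]) auto
  qed
  have deriv_t: "((\<lambda>s. joint_mgf M (X s) u) has_real_derivative
    (\<Sum>i\<in>UNIV. (joint_mgf M (\<lambda>\<omega>. A \<omega> $ i) u - 1) * (\<integral>\<omega>. X t \<omega> $ i * exp (u \<bullet> X t \<omega>) \<partial>M))) (at t within {0..})"
    using assms(4) \<eta>
    by (intro mgf_time_derivative[OF tu(1) \<eta>(1)] fin) (auto simp: joint_mgf_finite_eq_inner L_def algebra_simps)
  have cancel: "(\<Sum>i\<in>UNIV. (\<psi> i - 1) * g i) + (\<Sum>i\<in>UNIV. (1 - \<psi> i) * g i) = 0" for \<psi> g :: "'c \<Rightarrow> real"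
    by (simp add: left_diff_distrib sum_subtractf)
  show ?thesis
    by (intro exI conjI allI) (rule deriv_t, rule deriv_u, rule cancel)
qed

end
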